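(* Let $a_1,a_2,a_3,b_1,b_2,b_3\in\mathbb{C}$ with $a_j-a_k\notin\mathbb{Z}$ for $j\ne k$, and let $\psi=\sum_{k=1}^{3}(b_k-a_k)$. Suppose that for some $i\in\{1,2,3\}$ the inequality $\Re(b_i)<\Re(a_k+1)$ holds for all $k\in\{1,2,3\}$, and write $\{1,2,3\}\setminus\{i\}=\{j_1,j_2\}$ and, for each $k$, $\{1,2,3\}\setminus\{k\}=\{k_1,k_2\}$. Assume further that $1-b_{j_1}+a_k$, $1-b_{j_2}+a_k$, $\psi-b_{j_1}+a_k$, $\psi-b_{j_2}+a_k$ are not in $\{0,-1,-2,\dots\}$ for $k=1,2,3$, so that all terms below are defined. Put $$T_k=\frac{\prod_{j=1}^3\sin(\pi(b_j-a_k))}{\sin(\pi(a_{k_1}-a_k))\sin(\pi(a_{k_2}-a_k))}\cdot\frac{\Gamma(1-b_{j_1}+a_k)\Gamma(1-b_{j_2}+a_k)}{\Gamma(\psi-b_{j_1}+a_k)\Gamma(\psi-b_{j_2}+a_k)}.$$ Then $$\sum_{k=1}^{3}T_k\;{}_{3}F_{2}\left({\psi-1,\ b_i-a_{k_1},\ b_i-a_{k_2}\atop \psi-b_{j_1}+a_k,\ \psi-b_{j_2}+a_k};1\right)=0$$ and $$\sum_{k=1}^{3}T_k\left\{(1-b_{j_1}+a_k)(1-b_{j_2}+a_k)\;{}_{3}F_{2}\left({\psi-2,\ b_i-a_{k_1},\ b_i-a_{k_2}\atop \psi-b_{j_1}+a_k,\ \psi-b_{j_2}+a_k};1\right)-a_k(2-\psi)\;{}_{3}F_{2}\left({\psi-1,\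 b_i-a_{k_1},\ b_i-a_{k_2}\atop \psi-b_{j_1}+a_k,\ \psi-b_{j_2}+a_k};1\right)\right\}=0.$$
   Context: ${}_3F_2(\alpha_1,\alpha_2,\alpha_3;\beta_1,\beta_2;1)=\sum_{n\ge0}\frac{(\alpha_1)_n(\alpha_2)_n(\alpha_3)_n}{(\beta_1)_n(\beta_2)_n\,n!}$ is the generalized hypergeometric series at unit argument, where $(x)_n=x(x+1)\cdots(x+n-1)$. *)

theory Defs
  imports "HOL-Analysis.Analysis"
begin

definition hypergeo_3F2_at_1 ::
  "complex \<Rightarrow> complex \<Rightarrow> complex \<Rightarrow> complex \<Rightarrow> complex \<Rightarrow> complex"
where
  "hypergeo_3F2_at_1 \<alpha>1 \<alpha>2 \<alpha>3 \<beta>1 \<beta>2 =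
     (\<Sum>n. pochhammer \<alpha>1 n * pochhammer \<alpha>2 n * pochhammer \<alpha>3 n /
          (pochhammer \<beta>1 n * pochhammer \<beta>2 n * fact n))"

lemma hypergeo_3F2_at_1_eq_eval_fps:
  "hypergeo_3F2_at_1 \<alpha>1 \<alpha>2 \<alpha>3 \<beta>1 \<beta>2 =
     eval_fps (fps_hypergeo [\<alpha>1, \<alpha>2, \<alpha>3] [\<beta>1, \<beta>2] 1) 1"
  by (simp add: hypergeo_3F2_at_1_def eval_fps_def fps_hypergeo_def mult.assoc)

end

theory Submission
  imports Defs
begin

text \<open>
  Put \<open>(x, y, z) = (b\<^sub>i, b\<^sub>j\<^sub>1, b\<^sub>j\<^sub>2)\<close>. If \<open>Re \<psi>\<close> is large, Thomae's transformation turns the two sums, up to a common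
  factor, into the sums of all residues of \<open>s\<^sup>e \<Prod>\<^sub>i \<Gamma>(a\<^sub>i - s) / \<Gamma>(b\<^sub>i - s)\<close> for \<open>e = 0\<close> and \<open>e = 1\<close>. These vanish, because
  they are limits of the sums of all residues of rational functions that decay at least like \<open>s\<^sup>-\<^sup>2\<close>.

  The restriction on \<open>\<psi>\<close> is removed by descent instead of analytic continuation: shifting \<open>z\<close> by 1 changes neither
  the convergence condition nor the validity of contiguous relations that express both summands at \<open>z\<close> linearly in
  the two summands at \<open>z + 1\<close>, with coefficients that do not depend on \<open>k\<close>. So both identities at \<open>z + N\<close>
  imply both identities at \<open>z\<close>.
\<close>

section \<open>Growth of Pochhammer symbols\<close>

text \<open>There are exactly two identities because a residue sum over \<open>3 * (N + 1)\<close>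
  nodes vanishes when its numerator, of degree at most \<open>e + 3 * N\<close>, stays two below the
  number of nodes; this allows e = 0 and e = 1. The braces in the second identity are what Thomae's
  transformation makes of the factor \<open>a k + n\<close> in the residue series: the series with
  \<psi> - 2 produces the part with \<open>n\<close>, the one with \<psi> - 1 the part with
  \<open>a k\<close>.

  Large Re \<psi> is needed twice: for absolute convergence of the double series behind Thomae's
  transformation, and for domination in the limit of the finite residue sums. Shifting
  \<open>z\<close> can achieve the former because the condition bounds Re \<psi> from below by a
  quantity free of \<open>z\<close>.

  Both identities have to descend together, since the contiguous relations mix them. As 1 - z + a k
  may reach a pole of Gamma while \<open>z\<close> grows, the intermediate statements use the
  reciprocal Gamma function, which is entire.\<close>

definition pochhammer_scale :: "complex \<Rightarrow> nat \<Rightarrow> complex" where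
  "pochhammer_scale \<alpha> n = fact n * of_nat (Suc n) powr (\<alpha> - 1)"

lemma pochhammer_scale_nonzero [simp]: "pochhammer_scale \<alpha> n \<noteq> 0"
  by (simp add: pochhammer_scale_def flip: of_nat_Suc)

lemma norm_pochhammer_scale:
  "norm (pochhammer_scale \<alpha> n) = fact n * real (Suc n) powr (Re \<alpha> - 1)"
proof -
  have "norm (complex_of_real (real (Suc n)) powr (\<alpha> - 1)) = real (Suc n) powr (Re \<alpha> - 1)"
    by (subst norm_powr_real_powr) auto
  then show ?thesis
    unfolding pochhammer_scale_def by (simp add: norm_mult norm_fact)
qed

lemma nonpos_Ints_Re_le: "z \<in> \<int>\<^sub>\<le>\<^sub>0 \<Longrightarrow> Re z \<le> 0"
  by (auto elim!: nonpos_Ints_cases)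

lemma LIMSEQ_shift_ratio: "(\<lambda>n. (\<alpha> + of_nat n) / of_nat (Suc n) :: complex) \<longlonglongrightarrow> 1"
proof -
  have "(\<lambda>n. 1 + (\<alpha> - 1) * inverse (of_nat (Suc n))) \<longlonglongrightarrow> 1 + (\<alpha> - 1) * 0"
    by (intro tendsto_intros LIMSEQ_Suc[OF lim_inverse_n])
  moreover have "1 + (\<alpha> - 1) * inverse (of_nat (Suc n)) = (\<alpha> + of_nat n) / of_nat (Suc n)" for n
    using of_nat_neq_0[of n, where 'a = complex] by (simp add: field_simps del: of_nat_Suc) simp
  ultimately show ?thesis by simp
qed

text \<open>The scale is the size n! n^(\<alpha> - 1) of Gamma (\<alpha> + n), with base
  \<open>Suc n\<close> so that it is nonzero at n = 0 too. The limit is the product formula for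
  1/Gamma: \<open>rGamma_series\<close> at \<open>Suc n\<close> contains two further Pochhammer
  factors, each asymptotic to \<open>Suc n\<close>, which are divided out. Poles of Gamma are no
  exception, as the limit is then 0.\<close>

lemma pochhammer_asymp: "(\<lambda>n. pochhammer \<alpha> n / pochhammer_scale \<alpha> n) \<longlonglongrightarrow> rGamma \<alpha>"
proof -
  have lim: "(\<lambda>n. rGamma_series \<alpha> (Suc n) / ((\<alpha> + of_nat n) / of_nat (Suc n)) /
                 ((\<alpha> + 1 + of_nat n) / of_nat (Suc n))) \<longlonglongrightarrow> rGamma \<alpha> / 1 / 1"
    by (intro tendsto_divide LIMSEQ_shift_ratio LIMSEQ_Suc[OF rGamma_series_LIMSEQ]) auto
  \<comment> \<open>Beyond the norm of \<alpha> no factor \<alpha> + m vanishes, so the two extra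
    factors can be cancelled.\<close>
  have "eventually (\<lambda>n. real n > norm \<alpha> + 1) sequentially"
    using filterlim_real_sequentially by (simp add: filterlim_at_top_dense)
  then have "eventually (\<lambda>n. rGamma_series \<alpha> (Suc n) / ((\<alpha> + of_nat n) / of_nat (Suc n)) /
                 ((\<alpha> + 1 + of_nat n) / of_nat (Suc n)) = pochhammer \<alpha> n / pochhammer_scale \<alpha> n) sequentially"
  proof eventually_elim
    case (elim n)
    have nz: "\<alpha> + of_nat m \<noteq> 0" if "m \<ge> n" for m
    proof
      assume "\<alpha> + of_nat m = 0"
      then have "\<alpha> = - of_nat m" by (simp add: eq_neg_iff_add_eq_0)
      then have "norm \<alpha> = real m" by simp
      with elim that show False by simp
    qed
    have nz1: "\<alpha> + of_nat n \<noteq> 0" and nz2: "\<alpha> + 1 + of_nat n \<noteq> 0"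
      using nz[of n] nz[of "Suc n"] by (auto simp: add_ac)
    have pow: "of_nat (Suc n) powr (\<alpha> - 1) = exp (\<alpha> * of_real (ln (of_nat (Suc n)))) / of_nat (Suc n)"
    proof -
      have "of_nat (Suc n) = exp (complex_of_real (ln (real (Suc n))))"
        by (subst exp_of_real) (simp del: of_nat_Suc)
      then show ?thesis
        by (simp add: powr_def exp_diff left_diff_distrib del: of_nat_Suc)
    qed
    have poch: "pochhammer \<alpha> (Suc n + 1) = pochhammer \<alpha> n * (\<alpha> + of_nat n) * (\<alpha> + 1 + of_nat n)"
      by (simp add: pochhammer_Suc add_ac)
    show ?case
      unfolding rGamma_series_def pochhammer_scale_def pow poch
      using nz1 nz2 of_nat_neq_0[of n, where 'a = complex] 
      by (simp add: divide_simps fact_Suc del: of_nat_Suc)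
  qed
  with lim show ?thesis
    by (simp add: filterlim_cong)
qed

text \<open>Away from the poles this inverts \<open>pochhammer_asymp\<close>, because
  \<open>rGamma \<gamma>\<close> is \<open>pochhammer \<gamma> n\<close> times
  \<open>rGamma (\<gamma> + of_nat n)\<close>. At a pole that quotient is 0/0; there the claim is
  carried down from \<gamma> + 1 by the functional equation, starting at some \<gamma> + m with
  positive real part.\<close>

lemma rGamma_shift_asymp: "(\<lambda>n. rGamma (\<gamma> + of_nat n) * pochhammer_scale \<gamma> n) \<longlonglongrightarrow> 1"
proof -
  have base: "(\<lambda>n. rGamma (\<gamma> + of_nat n) * pochhammer_scale \<gamma> n) \<longlonglongrightarrow> 1"
    if g: "\<gamma> \<notin> \<int>\<^sub>\<le>\<^sub>0" for \<gamma>
  proof -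
    have nz: "rGamma \<gamma> \<noteq> 0" using g by (simp add: rGamma_eq_zero_iff)
    have "(\<lambda>n. rGamma \<gamma> / (pochhammer \<gamma> n / pochhammer_scale \<gamma> n)) \<longlonglongrightarrow> rGamma \<gamma> / rGamma \<gamma>"
      by (intro tendsto_divide tendsto_const pochhammer_asymp nz)
    moreover have "rGamma \<gamma> / (pochhammer \<gamma> n / pochhammer_scale \<gamma> n)
        = rGamma (\<gamma> + of_nat n) * pochhammer_scale \<gamma> n" for n
    proof -
      have "pochhammer \<gamma> n \<noteq> 0" using g by (auto simp: pochhammer_eq_0_iff)
      then show ?thesis using pochhammer_rGamma[of \<gamma> n] by (simp add: field_simps)
    qed
    ultimately show ?thesis using nz by simp
  qed
  have step: "(\<lambda>n. rGamma (\<gamma> + of_nat n) * pochhammer_scale \<gamma> n) \<longlonglongrightarrow> 1"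
    if lim: "(\<lambda>n. rGamma (\<gamma> + 1 + of_nat n) * pochhammer_scale (\<gamma> + 1) n) \<longlonglongrightarrow> 1" for \<gamma>
  proof -
    have "(\<lambda>n. (rGamma (\<gamma> + 1 + of_nat n) * pochhammer_scale (\<gamma> + 1) n) * ((\<gamma> + of_nat n) / of_nat (Suc n))) \<longlonglongrightarrow> 1 * 1"
      by (intro tendsto_mult lim LIMSEQ_shift_ratio)
    moreover have "(rGamma (\<gamma> + 1 + of_nat n) * pochhammer_scale (\<gamma> + 1) n) * ((\<gamma> + of_nat n) / of_nat (Suc n))
       = rGamma (\<gamma> + of_nat n) * pochhammer_scale \<gamma> n" for n
      using rGamma_plus1[of "\<gamma> + of_nat n"] of_nat_neq_0[of n, where 'a = complex]
      by (simp add: pochhammer_scale_def powr_diff add_ac field_simps del: of_nat_Suc)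
    ultimately show ?thesis by simp
  qed
  obtain m where m: "\<gamma> + of_nat m \<notin> \<int>\<^sub>\<le>\<^sub>0"
  proof -
    obtain m where "real m > - Re \<gamma>" using reals_Archimedean2 by blast
    then have "Re (\<gamma> + of_nat m) > 0" by simp
    then show ?thesis using that[of m] nonpos_Ints_Re_le[of "\<gamma> + of_nat m"] by fastforce
  qed
  have "\<forall>\<gamma>. \<gamma> + of_nat m \<notin> \<int>\<^sub>\<le>\<^sub>0 \<longrightarrow> (\<lambda>n. rGamma (\<gamma> + of_nat n) * pochhammer_scale \<gamma> n) \<longlonglongrightarrow> 1"
  proof (induction m)
    case 0
    then show ?case using base by simp
  next
    case (Suc m)
    show ?case
    proof (intro allI impI)
      fix \<gamma> :: complex assume "\<gamma> + of_nat (Suc m) \<notin> \<int>\<^sub>\<le>\<^sub>0"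
      then have "\<gamma> + 1 + of_nat m \<notin> \<int>\<^sub>\<le>\<^sub>0" by (simp add: add_ac)
      with Suc.IH have "(\<lambda>n. rGamma (\<gamma> + 1 + of_nat n) * pochhammer_scale (\<gamma> + 1) n) \<longlonglongrightarrow> 1" by blast
      then show "(\<lambda>n. rGamma (\<gamma> + of_nat n) * pochhammer_scale \<gamma> n) \<longlonglongrightarrow> 1" by (rule step)
    qed
  qed
  with m show ?thesis by blast
qed

section \<open>Uniform bounds and summability criteria\<close>

lemma pochhammer_bound:
  obtains C where "C > 0" "\<And>n. norm (pochhammer \<alpha> n :: complex) \<le> C * (fact n * real (Suc n) powr (Re \<alpha> - 1))"
proof -
  have "Bseq (\<lambda>n. pochhammer \<alpha> n / pochhammer_scale \<alpha> n)"
    using pochhammer_asymp convergentI convergent_imp_Bseq by blast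
  then obtain C where C: "C > 0" "\<And>n. norm (pochhammer \<alpha> n / pochhammer_scale \<alpha> n) \<le> C"
    by (auto elim: BseqE)
  have "norm (pochhammer \<alpha> n) \<le> C * norm (pochhammer_scale \<alpha> n)" for n
    using C(2)[of n] by (simp add: norm_divide divide_le_eq)
  with C(1) that show ?thesis by (simp only: norm_pochhammer_scale)
qed

lemma rGamma_shift_bound:
  obtains C where "C > 0" "\<And>n. norm (rGamma (\<gamma> + of_nat n) :: complex) \<le> C * (real (Suc n) powr (1 - Re \<gamma>) / fact n)"
proof -
  have "Bseq (\<lambda>n. rGamma (\<gamma> + of_nat n) * pochhammer_scale \<gamma> n)"
    using rGamma_shift_asymp convergentI convergent_imp_Bseq by blast
  then obtain C where C: "C > 0" "\<And>n. norm (rGamma (\<gamma> + of_nat n) * pochhammer_scale \<gamma> n) \<le> C"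
    by (auto elim: BseqE)
  have "norm (rGamma (\<gamma> + of_nat n)) \<le> C * (real (Suc n) powr (1 - Re \<gamma>) / fact n)" for n
  proof -
    have "norm (rGamma (\<gamma> + of_nat n)) * (fact n * real (Suc n) powr (Re \<gamma> - 1)) \<le> C"
      using C(2)[of n] by (simp only: norm_mult norm_pochhammer_scale)
    then have "norm (rGamma (\<gamma> + of_nat n)) \<le> C / (fact n * real (Suc n) powr (Re \<gamma> - 1))"
      by (subst pos_le_divide_eq) auto
    also have "\<dots> = C * (real (Suc n) powr (1 - Re \<gamma>) / fact n)"
      using powr_minus[of "real (Suc n)" "Re \<gamma> - 1"] by (simp add: field_simps)
    finally show ?thesis .
  qed
  with C(1) that show ?thesis by blast
qed

lemma inverse_pochhammer_bound:
  assumes "\<gamma> \<notin> \<int>\<^sub>\<le>\<^sub>0"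
  obtains C where "C > 0" "\<And>n. norm (inverse (pochhammer \<gamma> n :: complex)) \<le> C * (real (Suc n) powr (1 - Re \<gamma>) / fact n)"
proof -
  obtain C where C: "C > 0" "\<And>n. norm (rGamma (\<gamma> + of_nat n)) \<le> C * (real (Suc n) powr (1 - Re \<gamma>) / fact n)"
    using rGamma_shift_bound by blast
  have nz: "rGamma \<gamma> \<noteq> 0" using assms by (simp add: rGamma_eq_zero_iff)
  have "norm (inverse (pochhammer \<gamma> n)) \<le> C / norm (rGamma \<gamma>) * (real (Suc n) powr (1 - Re \<gamma>) / fact n)" for n
  proof -
    have "pochhammer \<gamma> n \<noteq> 0" using assms by (auto simp: pochhammer_eq_0_iff)
    then have "inverse (pochhammer \<gamma> n) = rGamma (\<gamma> + of_nat n) / rGamma \<gamma>"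
      using pochhammer_rGamma[of \<gamma> n] nz by (simp add: field_simps)
    then show ?thesis using divide_right_mono[OF C(2)[of n], of "norm (rGamma \<gamma>)"] by (simp add: norm_divide mult.commute)
  qed
  moreover have "C / norm (rGamma \<gamma>) > 0" using C nz by simp
  ultimately show ?thesis using that by blast
qed

lemma summable_Suc_powr: "a < -1 \<Longrightarrow> summable (\<lambda>n. real (Suc n) powr a)"
  using summable_Suc_iff[of "\<lambda>n. real n powr a"] by (simp add: summable_real_powr_iff)

lemma tendsto_zero_powr_bound:
  fixes f :: "nat \<Rightarrow> 'a :: real_normed_vector"
  assumes "\<And>n. norm (f n) \<le> C * real (Suc n) powr a" "a < 0"
  shows "f \<longlonglongrightarrow> 0"
proof (rule Lim_null_comparison)
  show "(\<lambda>n. C * real (Suc n) powr a) \<longlonglongrightarrow> 0"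
    using tendsto_neg_powr[OF assms(2) filterlim_compose[OF filterlim_real_sequentially filterlim_Suc]]
    by (intro tendsto_mult_right_zero)
qed (use assms in auto)

section \<open>Gauss's summation theorem\<close>

text \<open>Summand of the regularised series 2F1(b, c; \<gamma>; 1) / Gamma \<gamma>. With the
  reciprocal Gamma function inside, it is meaningful for every \<gamma>; in Thomae's double series
  \<gamma> = d + e - A may be a pole.\<close>

definition gauss_term :: "complex \<Rightarrow> complex \<Rightarrow> complex \<Rightarrow> nat \<Rightarrow> complex" where
  "gauss_term b c \<gamma> n = pochhammer b n * pochhammer c n / fact n * rGamma (\<gamma> + of_nat n)"

lemma gauss_term_bound:
  obtains C where "C > 0" "\<And>n. norm (gauss_term b c \<gamma> n) \<le> C * real (Suc n) powr (Re b + Re c - Re \<gamma> - 1)"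
proof -
  obtain B where B: "B > 0" "\<And>n. norm (pochhammer b n) \<le> B * (fact n * real (Suc n) powr (Re b - 1))"
    using pochhammer_bound by blast
  obtain C where C: "C > 0" "\<And>n. norm (pochhammer c n) \<le> C * (fact n * real (Suc n) powr (Re c - 1))"
    using pochhammer_bound by blast
  obtain D where D: "D > 0" "\<And>n. norm (rGamma (\<gamma> + of_nat n)) \<le> D * (real (Suc n) powr (1 - Re \<gamma>) / fact n)"
    using rGamma_shift_bound by blast
  have "norm (gauss_term b c \<gamma> n) \<le> B * C * D * real (Suc n) powr (Re b + Re c - Re \<gamma> - 1)" for n
  proof -
    let ?u = "real (Suc n)"
    have "norm (gauss_term b c \<gamma> n) = norm (pochhammer b n) * norm (pochhammer c n) / fact n * norm (rGamma (\<gamma> + of_nat n))"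
      by (simp add: gauss_term_def norm_mult norm_divide norm_fact)
    also have "\<dots> \<le> (B * (fact n * ?u powr (Re b - 1))) * (C * (fact n * ?u powr (Re c - 1))) / fact n
                   * (D * (?u powr (1 - Re \<gamma>) / fact n))"
      using B C D by (intro mult_mono divide_right_mono) auto
    also have "\<dots> = B * C * D * (?u powr (Re b - 1) * ?u powr (Re c - 1) * ?u powr (1 - Re \<gamma>))"
      by (simp del: of_nat_Suc)
    also have "?u powr (Re b - 1) * ?u powr (Re c - 1) * ?u powr (1 - Re \<gamma>) = ?u powr (Re b + Re c - Re \<gamma> - 1)"
      unfolding powr_add[symmetric] by (rule arg_cong[where f = "\<lambda>x. ?u powr x"]) simp
    finally show ?thesis .
  qed
  moreover have "B * C * D > 0" using B C D by simp
  ultimately show ?thesis using that by blast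
qed

lemma summable_norm_gauss_term:
  assumes "Re (\<gamma> - b - c) > 0"
  shows "summable (\<lambda>n. norm (gauss_term b c \<gamma> n))"
proof -
  obtain C where C: "\<And>n. norm (gauss_term b c \<gamma> n) \<le> C * real (Suc n) powr (Re b + Re c - Re \<gamma> - 1)"
    using gauss_term_bound by metis
  show ?thesis
  proof (rule summable_comparison_test'[where N = 0])
    show "summable (\<lambda>n. C * real (Suc n) powr (Re b + Re c - Re \<gamma> - 1))"
      using assms by (intro summable_mult summable_Suc_powr) simp
  qed (use C in simp)
qed

lemmas summable_gauss_term = summable_norm_cancel[OF summable_norm_gauss_term]

text \<open>Telescoping: the difference of the two summands has the antidifference n times the
  summand at \<gamma>, which starts at 0 and tends to 0 because Re (\<gamma> - b - c) is
  positive.\<close>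

lemma gauss_contiguous:
  assumes s: "Re (\<gamma> - b - c) > 0"
  shows "(\<gamma> - b - c) * suminf (gauss_term b c \<gamma>) = (\<gamma> - b) * (\<gamma> - c) * suminf (gauss_term b c (\<gamma> + 1))"
proof -
  define r where "r n = of_nat n * gauss_term b c \<gamma> n" for n
  obtain C where C: "C > 0" "\<And>n. norm (gauss_term b c \<gamma> n) \<le> C * real (Suc n) powr (Re b + Re c - Re \<gamma> - 1)"
    using gauss_term_bound by metis
  have r0: "r \<longlonglongrightarrow> 0"
  proof (rule tendsto_zero_powr_bound)
    fix n
    have "norm (r n) = real n * norm (gauss_term b c \<gamma> n)"
      by (simp add: r_def norm_mult)
    also have "\<dots> \<le> real (Suc n) * (C * real (Suc n) powr (Re b + Re c - Re \<gamma> - 1))"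
      using C by (intro mult_mono) auto
    also have "\<dots> = C * real (Suc n) powr (Re b + Re c - Re \<gamma>)"
      by (simp add: powr_diff del: of_nat_Suc)
    finally show "norm (r n) \<le> C * real (Suc n) powr (Re b + Re c - Re \<gamma>)" .
  qed (use s in simp)
  have "(\<lambda>n. r (Suc n) - r n) sums (0 - r 0)"
    by (rule telescope_sums[OF r0])
  moreover have "r (Suc n) - r n = (\<gamma> - b) * (\<gamma> - c) * gauss_term b c (\<gamma> + 1) n
                   - (\<gamma> - b - c) * gauss_term b c \<gamma> n" for n
  proof -
    define u where "u = pochhammer b n * pochhammer c n / fact n"
    define v where "v = rGamma (\<gamma> + of_nat n + 1)"
    have t: "gauss_term b c \<gamma> n = u * ((\<gamma> + of_nat n) * v)"
      using rGamma_plus1[of "\<gamma> + of_nat n"] by (simp add: gauss_term_def u_def v_def)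
    have t1: "gauss_term b c (\<gamma> + 1) n = u * v"
      by (simp add: gauss_term_def u_def v_def add_ac)
    have r1: "r (Suc n) = (b + of_nat n) * (c + of_nat n) * u * v"
    proof -
      have "\<gamma> + of_nat (Suc n) = \<gamma> + of_nat n + 1" by simp
      then show ?thesis using of_nat_neq_0[of n, where 'a = complex]
        by (simp add: r_def gauss_term_def u_def v_def pochhammer_Suc fact_Suc add.assoc del: of_nat_Suc)
    qed
    show ?thesis unfolding r1 t1 unfolding r_def t by (simp add: algebra_simps)
  qed
  moreover have "r 0 = 0" by (simp add: r_def)
  ultimately have "(\<lambda>n. (\<gamma> - b) * (\<gamma> - c) * gauss_term b c (\<gamma> + 1) n
                   - (\<gamma> - b - c) * gauss_term b c \<gamma> n) sums 0" by simp
  moreover have "(\<lambda>n. (\<gamma> - b) * (\<gamma> - c) * gauss_term b c (\<gamma> + 1) n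
                   - (\<gamma> - b - c) * gauss_term b c \<gamma> n) sums
        ((\<gamma> - b) * (\<gamma> - c) * suminf (gauss_term b c (\<gamma> + 1)) - (\<gamma> - b - c) * suminf (gauss_term b c \<gamma>))"
    using s by (intro sums_diff sums_mult summable_sums summable_gauss_term) auto
  ultimately have "(\<gamma> - b) * (\<gamma> - c) * suminf (gauss_term b c (\<gamma> + 1)) - (\<gamma> - b - c) * suminf (gauss_term b c \<gamma>) = 0"
    by (rule sums_unique2[symmetric])
  then show ?thesis by simp
qed

lemma gauss_contiguous_iterate:
  assumes s: "Re (\<gamma> - b - c) > 0"
  shows "pochhammer (\<gamma> - b - c) N * suminf (gauss_term b c \<gamma>)
     = pochhammer (\<gamma> - b) N * pochhammer (\<gamma> - c) N * suminf (gauss_term b c (\<gamma> + of_nat N))"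
proof (induction N)
  case (Suc N)
  have "(\<gamma> - b - c + of_nat N) * suminf (gauss_term b c (\<gamma> + of_nat N)) =
      (\<gamma> - b + of_nat N) * (\<gamma> - c + of_nat N) * suminf (gauss_term b c (\<gamma> + of_nat (Suc N)))"
    using gauss_contiguous[of "\<gamma> + of_nat N" b c] s by (simp add: algebra_simps)
  note step = this
  have "pochhammer (\<gamma> - b - c) (Suc N) * suminf (gauss_term b c \<gamma>)
      = (\<gamma> - b - c + of_nat N) * (pochhammer (\<gamma> - b - c) N * suminf (gauss_term b c \<gamma>))"
    by (simp only: pochhammer_Suc mult_ac)
  also have "\<dots> = pochhammer (\<gamma> - b) N * pochhammer (\<gamma> - c) N *
      ((\<gamma> - b - c + of_nat N) * suminf (gauss_term b c (\<gamma> + of_nat N)))"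
    unfolding Suc.IH by (simp only: mult_ac)
  also have "\<dots> = pochhammer (\<gamma> - b) (Suc N) * pochhammer (\<gamma> - c) (Suc N) * suminf (gauss_term b c (\<gamma> + of_nat (Suc N)))"
    unfolding step by (simp only: pochhammer_Suc mult_ac)
  finally show ?case .
qed simp

lemma norm_pochhammer_ge:
  fixes w :: complex
  assumes "\<rho> \<ge> 0" "Re w \<ge> \<rho>"
  shows "norm (pochhammer w n) \<ge> pochhammer \<rho> n"
proof (induction n)
  case (Suc n)
  have "\<rho> + real n \<le> norm (w + of_nat n)"
    using assms complex_Re_le_cmod[of "w + of_nat n"] by simp
  then show ?case using Suc assms unfolding pochhammer_Suc norm_mult
    by (intro mult_mono) auto
qed simp

text \<open>Iterating the contiguous relation, the three Pochhammer scales combine into that of \<open>\<gamma>\<close>, so that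
  only the limit of the shifted series is needed; dominated convergence reduces it to its first term.\<close>

lemma gauss_sum_asymp: "(\<lambda>N. suminf (gauss_term b c (\<gamma> + of_nat N)) * pochhammer_scale \<gamma> N) \<longlonglongrightarrow> 1"
proof -
  obtain K where K: "K > 0" "\<And>N. norm (rGamma (\<gamma> + of_nat N) * pochhammer_scale \<gamma> N) \<le> K"
    using convergent_imp_Bseq[OF convergentI[OF rGamma_shift_asymp[of \<gamma>]]] by (auto elim: BseqE)
  \<comment> \<open>\<open>N0\<close> makes \<rho> at least 1 and larger than Re b + Re c, so that
    Gauss's series with \<rho> in place of \<gamma> converges absolutely and can dominate all series
    with N at least \<open>N0\<close>.\<close>
  obtain N0 :: nat where N0: "real N0 > 1 + \<bar>Re \<gamma>\<bar> + \<bar>Re b + Re c\<bar>" using reals_Archimedean2 by blast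
  define \<rho> where "\<rho> = Re \<gamma> + real N0"
  have \<rho>: "\<rho> \<ge> 1" "\<rho> > Re b + Re c" using N0 by (auto simp: \<rho>_def)
  define u where "u n = pochhammer b n * pochhammer c n / fact n" for n
  define a where "a n N = gauss_term b c (\<gamma> + of_nat N) n * pochhammer_scale \<gamma> N" for n N
  have a_eq: "a n N = u n * (rGamma (\<gamma> + of_nat N) * pochhammer_scale \<gamma> N) / pochhammer (\<gamma> + of_nat N) n"
    and "pochhammer (\<gamma> + of_nat N) n \<noteq> 0" if "N \<ge> N0" for n N
  proof -
    have "Re (\<gamma> + of_nat N) > 0" using that \<rho> by (simp add: \<rho>_def)
    then have "\<gamma> + of_nat N \<notin> \<int>\<^sub>\<le>\<^sub>0" using nonpos_Ints_Re_le by fastforce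
    then show nz: "pochhammer (\<gamma> + of_nat N) n \<noteq> 0" by (auto simp: pochhammer_eq_0_iff)
    show "a n N = u n * (rGamma (\<gamma> + of_nat N) * pochhammer_scale \<gamma> N) / pochhammer (\<gamma> + of_nat N) n"
      using nz unfolding a_def gauss_term_def u_def pochhammer_rGamma[of "\<gamma> + of_nat N" n] by simp
  qed
  \<comment> \<open>\<sigma> is left free for two uses: \<sigma> = \<rho> gives a majorant uniform
    in \<open>N\<close>, and \<sigma> = Re \<gamma> + N gives the decay in \<open>N\<close> of each
    single term with n > 0.\<close>
  have bound: "norm (a n N) \<le> norm (u n) * K / pochhammer \<sigma> n"
    if "N \<ge> N0" "\<sigma> > 0" "Re \<gamma> + real N \<ge> \<sigma>" for n N \<sigma>
  proof -
    have "pochhammer \<sigma> n \<le> norm (pochhammer (\<gamma> + of_nat N) n)"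
      by (rule norm_pochhammer_ge) (use that in simp_all)
    moreover have "pochhammer \<sigma> n > 0" using that(2) by (rule pochhammer_pos)
    moreover have "norm (u n * (rGamma (\<gamma> + of_nat N) * pochhammer_scale \<gamma> N)) \<le> norm (u n) * K"
      unfolding norm_mult[of "u n"] by (rule mult_left_mono[OF K(2)]) simp
    ultimately show ?thesis unfolding a_eq[OF that(1)] norm_divide
      using K by (intro frac_le) auto
  qed
  have lim: "(\<lambda>N. a n N) \<longlonglongrightarrow> (if n = 0 then 1 else 0)" for n
  proof (cases n)
    case 0
    then show ?thesis using rGamma_shift_asymp[of \<gamma>] by (simp add: a_def gauss_term_def)
  next
    case (Suc k)
    have "(\<lambda>N. a n N) \<longlonglongrightarrow> 0"
    proof (rule Lim_null_comparison)
      show "eventually (\<lambda>N. norm (a n N) \<le> norm (u n) * K * inverse (Re \<gamma> + real N)) sequentially"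
        using eventually_ge_at_top[of N0]
      proof eventually_elim
        case (elim N)
        define \<sigma> where "\<sigma> = Re \<gamma> + real N"
        have \<sigma>: "\<sigma> \<ge> 1" using elim \<rho> by (simp add: \<sigma>_def \<rho>_def)
        have "pochhammer \<sigma> n = \<sigma> * pochhammer (\<sigma> + 1) k" by (simp add: Suc pochhammer_rec)
        moreover have "pochhammer (\<sigma> + 1) k \<ge> 1"
        proof (induction k)
          case (Suc k)
          have "1 * 1 \<le> pochhammer (\<sigma> + 1) k * (\<sigma> + 1 + real k)"
            using Suc \<sigma> by (intro mult_mono) auto
          then show ?case by (simp add: pochhammer_Suc)
        qed simp
        ultimately have "pochhammer \<sigma> n \<ge> \<sigma>" using \<sigma> by simp
        have "norm (a n N) \<le> norm (u n) * K / pochhammer \<sigma> n"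
          using \<sigma> elim by (intro bound) (auto simp: \<sigma>_def)
        also have "\<dots> \<le> norm (u n) * K / \<sigma>"
          using \<open>pochhammer \<sigma> n \<ge> \<sigma>\<close> \<sigma> K by (intro divide_left_mono) auto
        finally show ?case by (simp add: \<sigma>_def field_simps)
      qed
      have "filterlim (\<lambda>N. Re \<gamma> + real N) at_top sequentially"
        by (rule filterlim_tendsto_add_at_top[OF tendsto_const filterlim_real_sequentially])
      then show "(\<lambda>N. norm (u n) * K * inverse (Re \<gamma> + real N)) \<longlonglongrightarrow> 0"
        by (intro tendsto_mult_right_zero tendsto_inverse_0_at_top)
    qed
    then show ?thesis by (simp add: Suc)
  qed
  \<comment> \<open>Up to a constant factor, the majorant is the norm of \<open>gauss_term\<close>
    at the real parameter \<rho>.\<close>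
  have summ: "summable (\<lambda>n. norm (u n) * K / pochhammer \<rho> n)"
  proof -
    have "complex_of_real \<rho> \<notin> \<int>\<^sub>\<le>\<^sub>0" using \<rho> nonpos_Ints_Re_le by fastforce
    then have nz: "rGamma (complex_of_real \<rho>) \<noteq> 0" by (simp add: rGamma_eq_zero_iff)
    have "summable (\<lambda>n. norm (gauss_term b c (of_real \<rho>) n) * (K / norm (rGamma (complex_of_real \<rho>))))"
      using \<rho> by (intro summable_mult2 summable_norm_gauss_term) auto
    moreover have "norm (gauss_term b c (of_real \<rho>) n) * (K / norm (rGamma (complex_of_real \<rho>)))
        = norm (u n) * K / pochhammer \<rho> n" for n
    proof -
      have pos: "pochhammer \<rho> n > 0" using \<rho> by (intro pochhammer_pos) auto
      have "rGamma (complex_of_real \<rho>) = pochhammer (of_real \<rho>) n * rGamma (of_real \<rho> + of_nat n)"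
        by (rule pochhammer_rGamma)
      then have "norm (rGamma (complex_of_real \<rho>)) = pochhammer \<rho> n * norm (rGamma (of_real \<rho> + of_nat n :: complex))"
        using pos by (simp add: norm_mult pochhammer_of_real)
      moreover from this have "rGamma (of_real \<rho> + of_nat n :: complex) \<noteq> 0" using nz by auto
      ultimately show ?thesis using pos nz
        by (simp add: gauss_term_def u_def norm_mult norm_divide field_simps)
    qed
    ultimately show ?thesis by (simp only:)
  qed
  have "eventually (\<lambda>(n, N). norm (a n N) \<le> norm (u n) * K / pochhammer \<rho> n) (at_top \<times>\<^sub>F sequentially)"
    unfolding eventually_prod_filter
    using \<rho> by (intro exI[of _ "\<lambda>_. True"] exI[of _ "\<lambda>N. N \<ge> N0"])
      (auto simp: eventually_ge_at_top \<rho>_def intro!: bound)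
  from tannerys_theorem[OF lim this summ]
  have "(\<lambda>N. suminf (\<lambda>n. a n N)) \<longlonglongrightarrow> suminf (\<lambda>n. if n = 0 then 1 else 0)" by simp
  moreover have "suminf (\<lambda>n. if n = 0 then 1 else 0 :: complex) = 1"
    using sums_If_finite_set[of "{0::nat}" "\<lambda>_. 1 :: complex"] by (simp add: sums_iff)
  moreover have "eventually (\<lambda>N. suminf (\<lambda>n. a n N) = suminf (gauss_term b c (\<gamma> + of_nat N)) * pochhammer_scale \<gamma> N) sequentially"
    using eventually_ge_at_top[of N0]
  proof eventually_elim
    case (elim N)
    have "summable (gauss_term b c (\<gamma> + of_nat N))"
      using elim \<rho> by (intro summable_gauss_term) (simp add: \<rho>_def)
    then show ?case unfolding a_def by (simp add: suminf_mult2)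
  qed
  ultimately show ?thesis by (simp add: filterlim_cong)
qed

text \<open>One sequence has two limits. Written with the shifted series it is a product of three
  factors with known limits; by the iterated contiguous relation it is also a normalised Pochhammer
  symbol of \<gamma> - b - c times the fixed sum. The limit \<open>rGamma (\<gamma> - b - c)\<close>
  of that symbol is nonzero, so it can be divided out.\<close>

theorem gauss_sum:
  assumes s: "Re (\<gamma> - b - c) > 0"
  shows "suminf (gauss_term b c \<gamma>) = Gamma (\<gamma> - b - c) * rGamma (\<gamma> - b) * rGamma (\<gamma> - c)"
proof -
  let ?s = "\<gamma> - b - c"
  have "(\<lambda>N. pochhammer (\<gamma> - b) N / pochhammer_scale (\<gamma> - b) N * (pochhammer (\<gamma> - c) N / pochhammer_scale (\<gamma> - c) N)
          * (suminf (gauss_term b c (\<gamma> + of_nat N)) * pochhammer_scale \<gamma> N)) \<longlonglongrightarrow> rGamma (\<gamma> - b) * rGamma (\<gamma> - c) * 1"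
    by (intro tendsto_mult pochhammer_asymp gauss_sum_asymp)
  moreover have "pochhammer (\<gamma> - b) N / pochhammer_scale (\<gamma> - b) N * (pochhammer (\<gamma> - c) N / pochhammer_scale (\<gamma> - c) N)
          * (suminf (gauss_term b c (\<gamma> + of_nat N)) * pochhammer_scale \<gamma> N)
      = pochhammer ?s N / pochhammer_scale ?s N * suminf (gauss_term b c \<gamma>)" for N
  proof -
    have "pochhammer_scale (\<gamma> - b) N * pochhammer_scale (\<gamma> - c) N = pochhammer_scale ?s N * pochhammer_scale \<gamma> N"
      unfolding pochhammer_scale_def by (simp add: algebra_simps del: of_nat_Suc flip: powr_add)
    note scale = this
    have "pochhammer (\<gamma> - b) N / pochhammer_scale (\<gamma> - b) N * (pochhammer (\<gamma> - c) N / pochhammer_scale (\<gamma> - c) N)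
          * (suminf (gauss_term b c (\<gamma> + of_nat N)) * pochhammer_scale \<gamma> N)
        = pochhammer (\<gamma> - b) N * pochhammer (\<gamma> - c) N * suminf (gauss_term b c (\<gamma> + of_nat N)) * pochhammer_scale \<gamma> N
          / (pochhammer_scale (\<gamma> - b) N * pochhammer_scale (\<gamma> - c) N)"
      by simp
    also have "\<dots> = pochhammer ?s N / pochhammer_scale ?s N * suminf (gauss_term b c \<gamma>)"
      unfolding scale gauss_contiguous_iterate[OF s, of N, symmetric] by simp
    finally show ?thesis .
  qed
  ultimately have "(\<lambda>N. pochhammer ?s N / pochhammer_scale ?s N * suminf (gauss_term b c \<gamma>)) \<longlonglongrightarrow> rGamma (\<gamma> - b) * rGamma (\<gamma> - c)"
    by simp
  moreover have "(\<lambda>N. pochhammer ?s N / pochhammer_scale ?s N * suminf (gauss_term b c \<gamma>)) \<longlonglongrightarrow> rGamma ?s * suminf (gauss_term b c \<gamma>)"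
    by (intro tendsto_mult pochhammer_asymp tendsto_const)
  ultimately have "rGamma ?s * suminf (gauss_term b c \<gamma>) = rGamma (\<gamma> - b) * rGamma (\<gamma> - c)"
    using LIMSEQ_unique by blast
  moreover have "rGamma ?s \<noteq> 0" using s nonpos_Ints_Re_le[of ?s] by (auto simp: rGamma_eq_zero_iff)
  ultimately show ?thesis by (simp add: Gamma_def field_simps)
qed

section \<open>Thomae's transformation\<close>

text \<open>The product majorant makes the family summable over all pairs, so Fubini for
  unconditional sums applies. Absolute summability of the rows, of the columns and of the sequences
  of their sums translates \<open>infsum\<close> back into \<open>suminf\<close>.\<close>

lemma suminf_swap_dominated:
  fixes t :: "nat \<Rightarrow> nat \<Rightarrow> complex"
  assumes bound: "\<And>n m. norm (t n m) \<le> G n * H m"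
    and G: "summable G" "\<And>n. G n \<ge> 0" and H: "summable H" "\<And>n. H n \<ge> 0"
  shows "(\<Sum>n. \<Sum>m. t n m) = (\<Sum>m. \<Sum>n. t n m)"
    and "summable (\<lambda>n. \<Sum>m. t n m)"
proof -
  have G': "G summable_on UNIV" and H': "H summable_on UNIV"
    using G H by (auto intro!: norm_summable_imp_summable_on)
  have "(\<lambda>x. norm ((\<lambda>(n, m). G n * H m) x)) summable_on UNIV \<times> UNIV"
    by (rule Infinite_Sum.abs_summable_on_Sigma_iff[THEN iffD2]) (use G H G' H' in \<open>auto simp: abs_mult infsum_cmult_right' intro!: summable_on_cmult_right summable_on_cmult_left\<close>)
  then have "(\<lambda>(n, m). G n * H m) summable_on UNIV \<times> UNIV"
    by (rule abs_summable_summable)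
  then have "(\<lambda>x. norm (case x of (n, m) \<Rightarrow> t n m)) summable_on UNIV \<times> UNIV"
    by (rule summable_on_comparison_test) (auto intro: bound)
  then have prod: "(\<lambda>(n, m). t n m) summable_on UNIV \<times> UNIV"
    by (rule abs_summable_summable)
  have conv: "infsum f UNIV = suminf f" if "summable (\<lambda>n. norm (f n))" for f :: "nat \<Rightarrow> complex"
    using norm_summable_imp_has_sum[OF that summable_sums[OF summable_norm_cancel[OF that]]]
    by (rule infsumI)
  have row: "summable (\<lambda>m. norm (t n m))" for n
    by (rule summable_comparison_test'[OF summable_mult[OF H(1), of "G n"], of 0]) (simp add: bound)
  have col: "summable (\<lambda>n. norm (t n m))" for m
    by (rule summable_comparison_test'[OF summable_mult2[OF G(1), of "H m"], of 0]) (simp add: bound)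
  have "norm (\<Sum>m. t n m) \<le> G n * suminf H" for n
  proof -
    have "norm (\<Sum>m. t n m) \<le> (\<Sum>m. norm (t n m))" by (rule summable_norm[OF row])
    also have "\<dots> \<le> (\<Sum>m. G n * H m)" by (intro suminf_le bound row summable_mult H)
    also have "\<dots> = G n * suminf H" by (rule suminf_mult[OF H(1)])
    finally show ?thesis .
  qed
  then have rows: "summable (\<lambda>n. norm (\<Sum>m. t n m))"
    by (intro summable_comparison_test'[OF summable_mult2[OF G(1), of "suminf H"], of 0]) simp
  have "norm (\<Sum>n. t n m) \<le> suminf G * H m" for m
  proof -
    have "norm (\<Sum>n. t n m) \<le> (\<Sum>n. norm (t n m))" by (rule summable_norm[OF col])
    also have "\<dots> \<le> (\<Sum>n. G n * H m)" by (intro suminf_le bound col summable_mult2 G)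
    also have "\<dots> = suminf G * H m" by (rule suminf_mult2[OF G(1), symmetric])
    finally show ?thesis .
  qed
  then have cols: "summable (\<lambda>m. norm (\<Sum>n. t n m))"
    by (intro summable_comparison_test'[OF summable_mult[OF H(1), of "suminf G"], of 0]) simp
  have "(\<Sum>n. \<Sum>m. t n m) = (\<Sum>\<^sub>\<infinity>n. \<Sum>\<^sub>\<infinity>m. t n m)"
    by (simp add: conv row rows)
  also have "\<dots> = (\<Sum>\<^sub>\<infinity>m. \<Sum>\<^sub>\<infinity>n. t n m)"
    by (rule infsum_swap_banach) (use prod in simp)
  also have "\<dots> = (\<Sum>m. \<Sum>n. t n m)"
    by (simp add: conv col cols)
  finally show "(\<Sum>n. \<Sum>m. t n m) = (\<Sum>m. \<Sum>n. t n m)" .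
  show "summable (\<lambda>n. \<Sum>m. t n m)" by (rule summable_norm_cancel[OF rows])
qed

text \<open>Separates \<open>n\<close> from \<open>m\<close> in the growth of
  \<open>rGamma (\<gamma> + of_nat (n + m))\<close>. The asymmetry is deliberate: \<open>n\<close>
  keeps the exact exponent, so that summation over \<open>n\<close> asks only for Re s > 0, while
  \<open>m\<close> pays the absolute value of the exponent, which is the origin of the absolute
  value in \<open>big\<close>.\<close>

lemma Suc_add_powr_le: "real (Suc (n + m)) powr r \<le> real (Suc n) powr r * real (Suc m) powr \<bar>r\<bar>"
proof (cases "r \<ge> 0")
  case True
  have "real (Suc (n + m)) \<le> real (Suc n) * real (Suc m)" by (simp add: algebra_simps)
  then have "real (Suc (n + m)) powr r \<le> (real (Suc n) * real (Suc m)) powr r"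
    using True by (intro powr_mono2) auto
  with True show ?thesis by (simp add: powr_mult del: of_nat_Suc)
next
  case False
  have "real (Suc (n + m)) powr r \<le> real (Suc n) powr r"
    using False by (intro powr_mono2') auto
  also have "\<dots> * 1 \<le> \<dots> * real (Suc m) powr \<bar>r\<bar>"
    by (intro mult_left_mono ge_one_powr_ge_zero) auto
  finally show ?thesis by simp
qed

lemma fact_mult_le_fact_add: "fact n * fact m \<le> (fact (n + m) :: real)"
proof -
  have "fact n * fact m dvd (fact (n + m) :: nat)"
    using fact_fact_dvd_fact[of n m] by simp
  then have "fact n * fact m \<le> (fact (n + m) :: nat)"
    by (intro dvd_imp_le) auto
  then have "real (fact n * fact m) \<le> real (fact (n + m))" by (rule of_nat_mono)
  then show ?thesis by simp
qed

text \<open>Gauss's theorem expands \<open>\<Gamma>(A + n) / (\<Gamma>(d + n) \<Gamma>(e + n))\<close> into a series over \<open>m\<close>, and sums the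
  double series over \<open>n\<close> again. The hypothesis \<open>big\<close> makes the double series converge absolutely.\<close>

theorem thomae_transformation:
  fixes A p q d e :: complex
  defines "s \<equiv> d + e - A - p - q"
  assumes A: "Re A > 0" and s: "Re s > 0"
    and big: "Re (d + e - A) + \<bar>1 - Re (d + e - A)\<bar> - Re A < 1"
  shows "(\<Sum>n. pochhammer A n * pochhammer p n * pochhammer q n / fact n * (rGamma (d + of_nat n) * rGamma (e + of_nat n)))
    = rGamma A * (\<Sum>m. pochhammer (d - A) m * pochhammer (e - A) m / fact m *
        (Gamma (s + of_nat m) * rGamma (s + p + of_nat m) * rGamma (s + q + of_nat m)))"
proof -
  define D E \<gamma> where "D = d - A" and "E = e - A" and "\<gamma> = d + e - A"
  define r where "r = 1 - Re \<gamma>"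
  \<comment> \<open>The parameters fit Gauss's theorem in both directions. Over \<open>m\<close>,
    with upper parameters D and E: \<gamma> - D = e, \<gamma> - E = d and \<gamma> - D - E = A. Over
    \<open>n\<close>, with p and q: \<gamma> - p = s + q, \<gamma> - q = s + p and \<gamma> - p - q
    = s.\<close>
  define t where "t n m = pochhammer p n * pochhammer q n / fact n * (pochhammer D m * pochhammer E m / fact m)
     * rGamma (\<gamma> + of_nat (n + m))" for n m
  obtain P where P: "P > 0" "\<And>n. norm (pochhammer p n) \<le> P * (fact n * real (Suc n) powr (Re p - 1))"
    using pochhammer_bound by blast
  obtain Q where Q: "Q > 0" "\<And>n. norm (pochhammer q n) \<le> Q * (fact n * real (Suc n) powr (Re q - 1))"
    using pochhammer_bound by blast
  obtain S where S: "S > 0" "\<And>n. norm (pochhammer D n) \<le> S * (fact n * real (Suc n) powr (Re D - 1))"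
    using pochhammer_bound by blast
  obtain T where T: "T > 0" "\<And>n. norm (pochhammer E n) \<le> T * (fact n * real (Suc n) powr (Re E - 1))"
    using pochhammer_bound by blast
  obtain C where C: "C > 0" "\<And>n. norm (rGamma (\<gamma> + of_nat n)) \<le> C * (real (Suc n) powr r / fact n)"
    using rGamma_shift_bound[of \<gamma>] unfolding r_def by blast
  define G where "G n = P * Q * C * real (Suc n) powr (- Re s - 1)" for n
  \<comment> \<open>As D + E = \<gamma> - A, the hypothesis \<open>big\<close> says precisely that
    this exponent is below -1.\<close>
  define H where "H m = S * T * real (Suc m) powr (Re D + Re E - 2 + \<bar>r\<bar>)" for m
  have bound: "norm (t n m) \<le> G n * H m" for n m
  proof -
    let ?u = "real (Suc n)" and ?v = "real (Suc m)"
    have "norm (rGamma (\<gamma> + of_nat (n + m))) \<le> C * (real (Suc (n + m)) powr r / fact (n + m))"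
      by (rule C)
    also have "\<dots> \<le> C * (?u powr r * ?v powr \<bar>r\<bar> / (fact n * fact m))"
      using C(1) by (intro mult_left_mono frac_le Suc_add_powr_le fact_mult_le_fact_add) auto
    finally have rG: "norm (rGamma (\<gamma> + of_nat (n + m))) \<le> C * (?u powr r * ?v powr \<bar>r\<bar> / (fact n * fact m))" .
    have "norm (t n m) = norm (pochhammer p n) * norm (pochhammer q n) / fact n *
        (norm (pochhammer D m) * norm (pochhammer E m) / fact m) * norm (rGamma (\<gamma> + of_nat (n + m)))"
      by (simp add: t_def norm_mult norm_divide norm_fact)
    also have "\<dots> \<le> (P * (fact n * ?u powr (Re p - 1))) * (Q * (fact n * ?u powr (Re q - 1))) / fact n *
        ((S * (fact m * ?v powr (Re D - 1))) * (T * (fact m * ?v powr (Re E - 1))) / fact m) *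
        (C * (?u powr r * ?v powr \<bar>r\<bar> / (fact n * fact m)))"
      using P Q S T C by (intro mult_mono divide_right_mono rG mult_nonneg_nonneg divide_nonneg_nonneg) (auto simp del: of_nat_Suc)
    also have "\<dots> = P * Q * C * (?u powr (Re p - 1) * ?u powr (Re q - 1) * ?u powr r) *
         (S * T * (?v powr (Re D - 1) * ?v powr (Re E - 1) * ?v powr \<bar>r\<bar>))"
      by (simp del: of_nat_Suc)
    also have "?u powr (Re p - 1) * ?u powr (Re q - 1) * ?u powr r = ?u powr (- Re s - 1)"
      unfolding powr_add[symmetric] by (rule arg_cong[where f = "\<lambda>x. ?u powr x"]) (simp add: r_def s_def \<gamma>_def)
    also have "?v powr (Re D - 1) * ?v powr (Re E - 1) * ?v powr \<bar>r\<bar> = ?v powr (Re D + Re E - 2 + \<bar>r\<bar>)"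
      unfolding powr_add[symmetric] by (rule arg_cong[where f = "\<lambda>x. ?v powr x"]) simp
    finally show ?thesis by (simp add: G_def H_def)
  qed
  have sG: "summable G" unfolding G_def using s by (intro summable_mult summable_Suc_powr) simp
  have sH: "summable H" unfolding H_def using big
    by (intro summable_mult summable_Suc_powr) (simp add: D_def E_def r_def \<gamma>_def)
  have nonneg: "G n \<ge> 0" "H n \<ge> 0" for n
    using P Q S T C by (auto simp: G_def H_def)
  note swap = suminf_swap_dominated[OF bound sG nonneg(1) sH nonneg(2)]
  have row: "(\<Sum>m. t n m) = Gamma A * (pochhammer A n * pochhammer p n * pochhammer q n / fact n * (rGamma (d + of_nat n) * rGamma (e + of_nat n)))" for n
  proof -
    have conv: "Re (\<gamma> + of_nat n - D - E) > 0" using A by (simp add: \<gamma>_def D_def E_def)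
    have "t n = (\<lambda>m. pochhammer p n * pochhammer q n / fact n * gauss_term D E (\<gamma> + of_nat n) m)"
      by (rule ext) (simp add: t_def gauss_term_def add_ac mult_ac)
    then have "(\<Sum>m. t n m) = pochhammer p n * pochhammer q n / fact n * suminf (gauss_term D E (\<gamma> + of_nat n))"
      by (simp only: suminf_mult[OF summable_gauss_term[OF conv]])
    also have "suminf (gauss_term D E (\<gamma> + of_nat n)) = Gamma (A + of_nat n) * (rGamma (e + of_nat n) * rGamma (d + of_nat n))"
      unfolding gauss_sum[OF conv] by (simp add: \<gamma>_def D_def E_def algebra_simps)
    also have "Gamma (A + of_nat n) = Gamma A * pochhammer A n"
      using pochhammer_Gamma[of A n] A nonpos_Ints_Re_le[of A] Gamma_eq_zero_iff[of A] by (auto simp: field_simps)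
    finally show ?thesis by (simp add: mult_ac)
  qed
  have col: "(\<Sum>n. t n m) = pochhammer (d - A) m * pochhammer (e - A) m / fact m *
        (Gamma (s + of_nat m) * rGamma (s + p + of_nat m) * rGamma (s + q + of_nat m))" for m
  proof -
    have conv: "Re (\<gamma> + of_nat m - p - q) > 0" using s by (simp add: \<gamma>_def s_def)
    have "(\<lambda>n. t n m) = (\<lambda>n. pochhammer D m * pochhammer E m / fact m * gauss_term p q (\<gamma> + of_nat m) n)"
      by (rule ext) (simp add: t_def gauss_term_def add_ac mult_ac)
    then have "(\<Sum>n. t n m) = pochhammer D m * pochhammer E m / fact m * suminf (gauss_term p q (\<gamma> + of_nat m))"
      by (simp only: suminf_mult[OF summable_gauss_term[OF conv]])
    also have "suminf (gauss_term p q (\<gamma> + of_nat m)) = Gamma (s + of_nat m) * rGamma (s + q + of_nat m) * rGamma (s + p + of_nat m)"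
      unfolding gauss_sum[OF conv] by (simp add: \<gamma>_def s_def algebra_simps)
    finally show ?thesis by (simp add: D_def E_def mult_ac)
  qed
  have nz: "Gamma A \<noteq> 0" using A nonpos_Ints_Re_le[of A] by (auto simp: Gamma_eq_zero_iff)
  define f where "f n = pochhammer A n * pochhammer p n * pochhammer q n / fact n * (rGamma (d + of_nat n) * rGamma (e + of_nat n))" for n
  have "summable (\<lambda>n. Gamma A * f n)" using swap(2) unfolding row f_def .
  then have "summable f" using nz by (simp add: summable_cmult_iff)
  have "suminf f = rGamma A * (Gamma A * suminf f)"
    using nz by (simp add: Gamma_def)
  also have "Gamma A * suminf f = (\<Sum>n. \<Sum>m. t n m)"
    unfolding row f_def[symmetric] by (rule suminf_mult[OF \<open>summable f\<close>, symmetric])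
  finally show ?thesis unfolding swap(1) col f_def .
qed

section \<open>Residue sums\<close>

text \<open>Up to sign these are the residues of a rational function that is O(s^-2) at infinity.
  The polynomial equals its Lagrange interpolant on X; the coefficient of degree
  \<open>card X - 1\<close> of that interpolant is the sum up to sign, and it is 0 for reasons of
  degree.\<close>

lemma sum_poly_over_nodes_eq_0:
  fixes X :: "complex set" and p :: "complex poly"
  assumes X: "finite X" and deg: "degree p + 2 \<le> card X"
  shows "(\<Sum>x\<in>X. poly p x / (\<Prod>y\<in>X - {x}. y - x)) = 0"
proof -
  define B where "B x = (\<Prod>y\<in>X - {x}. [:y, -1:])" for x :: complex
  define w where "w x = (\<Prod>y\<in>X - {x}. y - x)" for x
  define q where "q = (\<Sum>x\<in>X. smult (poly p x / w x) (B x))"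
  have w: "w x \<noteq> 0" for x using X by (auto simp: w_def)
  have degB: "degree (B x) = card X - 1" and coeffB: "coeff (B x) (card X - 1) = (-1) ^ (card X - 1)"
    if "x \<in> X" for x
  proof -
    have "degree (B x) = (\<Sum>y\<in>X - {x}. degree [:y, -1:])"
      unfolding B_def by (intro degree_prod_eq_sum_degree) auto
    then show "degree (B x) = card X - 1" using that X by simp
    moreover have "lead_coeff (B x) = (\<Prod>y\<in>X - {x}. lead_coeff [:y, -1:])"
      unfolding B_def by (rule lead_coeff_prod)
    ultimately show "coeff (B x) (card X - 1) = (-1) ^ (card X - 1)" using that X by simp
  qed
  have "p = q"
  proof (rule poly_eqI_degree[of X])
    fix x assume x: "x \<in> X"
    have "poly (B y) x = 0" if "y \<in> X - {x}" for y
      using that x X by (auto simp: B_def poly_prod)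
    then have "poly q x = poly p x / w x * poly (B x) x"
      using x X by (simp add: q_def poly_sum sum.remove[of X x])
    moreover have "poly (B x) x = w x" by (simp add: B_def w_def poly_prod)
    ultimately show "poly p x = poly q x" using w by simp
  next
    show "degree p < card X" using deg by simp
    have "degree q \<le> card X - 1" unfolding q_def
      by (intro degree_sum_le X) (auto intro: order_trans[OF degree_smult_le] simp: degB)
    then show "degree q < card X" using deg by linarith
  qed
  have "coeff p (card X - 1) = 0" using deg by (intro coeff_eq_0) simp
  then have "coeff q (card X - 1) = 0" by (simp add: \<open>p = q\<close>[symmetric])
  then have "(\<Sum>x\<in>X. poly p x / w x * (-1) ^ (card X - 1)) = 0"
    unfolding q_def by (simp add: coeff_sum coeffB del: One_nat_def cong: sum.cong)
  then have "(\<Sum>x\<in>X. poly p x / w x) * (-1) ^ (card X - 1) = 0"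
    by (simp only: sum_distrib_right)
  then show ?thesis by (simp add: w_def)
qed

text \<open>The factors \<beta> - n, ..., \<beta> - n + M - 1 are cut at \<beta>: the lower
  \<open>n\<close> of them are reflected, the others start at \<beta>. This separates the value at a
  node \<open>a k + n\<close> into a part depending on \<open>n\<close> and a part depending on
  \<open>N - n\<close>.\<close>

lemma pochhammer_minus_nat_split:
  fixes \<beta> :: complex
  assumes "n \<le> M"
  shows "pochhammer (\<beta> - of_nat n) M = (-1) ^ n * pochhammer (1 - \<beta>) n * pochhammer \<beta> (M - n)"
proof -
  have "pochhammer (1 - \<beta>) n = (-1) ^ n * pochhammer (\<beta> - of_nat n) n"
    using pochhammer_minus[of "\<beta> - 1" n] by simp
  then have "(-1) ^ n * pochhammer (1 - \<beta>) n = pochhammer (\<beta> - of_nat n) n"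
    by (simp flip: mult.assoc power_mult_distrib)
  then show ?thesis using pochhammer_product[OF assms, of "\<beta> - of_nat n"] by simp
qed

lemma prod_diff_nat_atMost:
  assumes "n \<le> N"
  shows "(\<Prod>j\<in>{..N} - {n}. of_nat j - of_nat n :: complex) = (-1) ^ n * fact n * fact (N - n)"
proof -
  have split: "{..N} - {n} = {..<n} \<union> {Suc n..N}" "{..<n} \<inter> {Suc n..N} = {}" using assms by auto
  have "(\<Prod>j<n. of_nat j - of_nat n :: complex) = (\<Prod>j<n. (-1) * of_nat (Suc j))"
    by (rule prod.reindex_bij_witness[of _ "\<lambda>j. n - Suc j" "\<lambda>j. n - Suc j"])
      (auto simp: of_nat_diff)
  also have "\<dots> = (-1) ^ n * (\<Prod>j<n. of_nat (Suc j))"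
    unfolding prod.distrib by simp
  also have "(\<Prod>j<n. of_nat (Suc j)) = (fact n :: complex)"
    by (simp add: fact_prod_Suc atLeast0LessThan)
  finally have 1: "(\<Prod>j<n. of_nat j - of_nat n :: complex) = (-1) ^ n * fact n" .
  have "(\<Prod>j\<in>{Suc n..N}. of_nat j - of_nat n :: complex) = (\<Prod>j<N - n. of_nat (Suc j))"
    by (rule prod.reindex_bij_witness[of _ "\<lambda>j. Suc (n + j)" "\<lambda>j. j - Suc n"])
      (auto simp: of_nat_diff)
  also have "\<dots> = fact (N - n)" by (simp add: fact_prod_Suc atLeast0LessThan)
  finally show ?thesis unfolding split(1) using split(2) 1
    by (subst prod.union_disjoint) auto
qed

text \<open>Up to sign, \<open>residue_coeff I a b k n * residue_cofactor I a b k (N - n)\<close> is the residue at \<open>s = a k + n\<close> of the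
  rational function \<open>\<Prod>\<^sub>i (b i - s)\<^sub>N / (a i - s)\<^sub>N\<^sub>+\<^sub>1\<close>, a finite version of \<open>\<Prod>\<^sub>i \<Gamma>(a i - s) / \<Gamma>(b i - s)\<close>.
  The factor \<open>i = k\<close> of \<open>residue_coeff\<close> contributes \<open>n!\<close> to the denominator.\<close>

definition residue_coeff :: "'i set \<Rightarrow> ('i \<Rightarrow> complex) \<Rightarrow> ('i \<Rightarrow> complex) \<Rightarrow> 'i \<Rightarrow> nat \<Rightarrow> complex" where
  "residue_coeff I a b k n = (\<Prod>i\<in>I. pochhammer (1 - b i + a k) n / pochhammer (1 - a i + a k) n)"

definition residue_cofactor :: "'i set \<Rightarrow> ('i \<Rightarrow> complex) \<Rightarrow> ('i \<Rightarrow> complex) \<Rightarrow> 'i \<Rightarrow> nat \<Rightarrow> complex" where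
  "residue_cofactor I a b k m =
     (\<Prod>i\<in>I. pochhammer (b i - a k) m / (if i = k then fact m else pochhammer (a i - a k) (Suc m)))"

text \<open>The nodes \<open>a k + n\<close> are distinct because the \<open>a k\<close> differ by
  non-integers. A numerator of degree at most e + |I| N faces |I| (N + 1) nodes, so the gap of two
  required for vanishing is e + 2 \<le> |I|. Every residue splits into a function of
  \<open>n\<close> times a function of \<open>N - n\<close>, so the sum over all nodes is a sum of
  convolutions.\<close>

lemma residue_convolution:
  fixes a b :: "'i \<Rightarrow> complex"
  assumes I: "finite I" and e: "e + 2 \<le> card I"
    and a: "\<And>j k. j \<in> I \<Longrightarrow> k \<in> I \<Longrightarrow> j \<noteq> k \<Longrightarrow> a j - a k \<notin> \<int>"
  shows "(\<Sum>k\<in>I. \<Sum>n\<le>N. (a k + of_nat n) ^ e * residue_coeff I a b k n * residue_cofactor I a b k (N - n)) = 0"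
proof -
  define \<phi> where "\<phi> = (\<lambda>(k, n). a k + of_nat n :: complex)"
  define S where "S = I \<times> {..N}"
  have inj: "inj_on \<phi> S"
  proof (rule inj_onI)
    fix s t assume s: "s \<in> S" and t: "t \<in> S" and eq: "\<phi> s = \<phi> t"
    obtain k n where s': "s = (k, n)" by (cases s)
    obtain l m where t': "t = (l, m)" by (cases t)
    have "a k - a l = of_int (int m - int n)" using eq by (simp add: s' t' \<phi>_def algebra_simps)
    then have "a k - a l \<in> \<int>" by (metis Ints_of_int)
    then have "k = l" using a s t by (auto simp: s' t' S_def)
    with eq show "s = t" by (simp add: s' t' \<phi>_def)
  qed
  define P where "P = [:0, 1:] ^ e * (\<Prod>i\<in>I. \<Prod>j<N. [:b i + of_nat j, -1:])"
  have polyP: "poly P x = x ^ e * (\<Prod>i\<in>I. pochhammer (b i - x) N)" for x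
    by (simp add: P_def poly_prod poly_power pochhammer_prod atLeast0LessThan algebra_simps)
  have "degree P \<le> e + card I * N"
  proof -
    have "degree ([:0, 1:] ^ e :: complex poly) \<le> e" by (simp add: degree_power_eq)
    moreover have "degree (\<Prod>j<N. [:b i + of_nat j, -1:]) \<le> N" for i
      by (rule order_trans[OF degree_prod_sum_le]) auto
    then have "degree (\<Prod>i\<in>I. \<Prod>j<N. [:b i + of_nat j, -1:]) \<le> (\<Sum>i\<in>I. N)"
      by (intro order_trans[OF degree_prod_sum_le] sum_mono I) simp
    ultimately show ?thesis unfolding P_def
      by (intro order_trans[OF degree_mult_le] add_mono) auto
  qed
  moreover have "card (\<phi> ` S) = card I * Suc N"
    using card_image[OF inj] by (simp add: S_def card_cartesian_product)
  ultimately have "(\<Sum>x\<in>\<phi> ` S. poly P x / (\<Prod>y\<in>\<phi> ` S - {x}. y - x)) = 0"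
    using e I by (intro sum_poly_over_nodes_eq_0) (auto simp: S_def)
  then have "(\<Sum>s\<in>S. poly P (\<phi> s) / (\<Prod>y\<in>\<phi> ` S - {\<phi> s}. y - \<phi> s)) = 0"
    by (simp add: sum.reindex[OF inj] o_def)
  also have "(\<Sum>s\<in>S. poly P (\<phi> s) / (\<Prod>y\<in>\<phi> ` S - {\<phi> s}. y - \<phi> s))
     = (\<Sum>(k, n)\<in>S. (a k + of_nat n) ^ e * residue_coeff I a b k n * residue_cofactor I a b k (N - n))"
  proof (rule sum.cong[OF refl], clarify)
    fix k n assume kn: "(k, n) \<in> S"
    then have k: "k \<in> I" and n: "n \<le> N" by (auto simp: S_def)
    have "\<phi> ` S - {\<phi> (k, n)} = \<phi> ` (S - {(k, n)})"
      using inj_on_image_set_diff[OF inj, of S "{(k, n)}"] kn by auto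
    then have "(\<Prod>y\<in>\<phi> ` S - {\<phi> (k, n)}. y - \<phi> (k, n)) = (\<Prod>s\<in>S - {(k, n)}. \<phi> s - \<phi> (k, n))"
      by (simp add: prod.reindex[OF inj_on_subset[OF inj]])
    \<comment> \<open>Only the ladder of \<open>k\<close> itself loses a point. Hence its factor is
      n! (N - n)! up to sign, while every other ladder contributes all N + 1 differences.\<close>
    also have "S - {(k, n)} = Sigma I (\<lambda>i. if i = k then {..N} - {n} else {..N})"
      by (auto simp: S_def split: if_splits)
    also have "(\<Prod>s\<in>\<dots>. \<phi> s - \<phi> (k, n)) =
        (\<Prod>i\<in>I. \<Prod>j\<in>(if i = k then {..N} - {n} else {..N}). a i + of_nat j - (a k + of_nat n))"
      using I by (subst prod.Sigma) (auto simp: \<phi>_def intro!: prod.cong)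
    also have "\<dots> = (\<Prod>i\<in>I. (-1) ^ n * (pochhammer (1 - a i + a k) n *
        (if i = k then fact (N - n) else pochhammer (a i - a k) (Suc (N - n)))))"
    proof (rule prod.cong[OF refl])
      fix i
      show "(\<Prod>j\<in>(if i = k then {..N} - {n} else {..N}). a i + of_nat j - (a k + of_nat n)) =
         (-1) ^ n * (pochhammer (1 - a i + a k) n *
        (if i = k then fact (N - n) else pochhammer (a i - a k) (Suc (N - n))))"
      proof (cases "i = k")
        case True
        then show ?thesis using prod_diff_nat_atMost[OF n] by (simp add: pochhammer_fact algebra_simps)
      next
        case False
        have "(\<Prod>j\<le>N. a i + of_nat j - (a k + of_nat n)) = pochhammer ((a i - a k) - of_nat n) (Suc N)"
          unfolding pochhammer_prod
          by (rule prod.cong) (auto simp: algebra_simps lessThan_Suc_atMost atLeast0LessThan)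
        also have "\<dots> = (-1) ^ n * pochhammer (1 - (a i - a k)) n * pochhammer (a i - a k) (Suc N - n)"
          using n by (intro pochhammer_minus_nat_split) simp
        finally show ?thesis using False n by (simp add: Suc_diff_le algebra_simps)
      qed
    qed
    finally have den: "(\<Prod>y\<in>\<phi> ` S - {\<phi> (k, n)}. y - \<phi> (k, n)) = \<dots>" .
    have "poly P (\<phi> (k, n)) = (a k + of_nat n) ^ e * (\<Prod>i\<in>I. pochhammer ((b i - a k) - of_nat n) N)"
      by (simp add: polyP \<phi>_def algebra_simps)
    also have "(\<Prod>i\<in>I. pochhammer ((b i - a k) - of_nat n) N) =
        (\<Prod>i\<in>I. (-1) ^ n * (pochhammer (1 - b i + a k) n * pochhammer (b i - a k) (N - n)))"
      by (rule prod.cong[OF refl], subst pochhammer_minus_nat_split[OF n]) (simp add: algebra_simps)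
    finally have num: "poly P (\<phi> (k, n)) = (a k + of_nat n) ^ e * \<dots>" .
    show "poly P (\<phi> (k, n)) / (\<Prod>y\<in>\<phi> ` S - {\<phi> (k, n)}. y - \<phi> (k, n)) =
       (a k + of_nat n) ^ e * residue_coeff I a b k n * residue_cofactor I a b k (N - n)"
      unfolding num den residue_coeff_def residue_cofactor_def
      by (simp add: mult.assoc flip: times_divide_eq_right prod_dividef prod.distrib cong: prod.cong)
        (auto intro!: prod.cong)
  qed
  finally show ?thesis unfolding S_def by (simp add: sum.cartesian_product)
qed

section \<open>Passage to the limit in the finite residue sums\<close>

lemma of_nat_Suc_powr_ratio:
  "(\<lambda>M. of_nat (Suc (M + n)) powr c / of_nat (Suc M) powr (c :: complex)) \<longlonglongrightarrow> 1"
proof -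
  have "(\<lambda>M. 1 + real n * inverse (real (Suc M))) \<longlonglongrightarrow> 1 + real n * 0"
    by (intro tendsto_intros LIMSEQ_Suc[OF lim_inverse_n])
  then have "(\<lambda>M. ln (1 + real n * inverse (real (Suc M)))) \<longlonglongrightarrow> ln (1 + real n * 0)"
    by (rule tendsto_ln) simp
  then have "(\<lambda>M. exp (c * of_real (ln (1 + real n * inverse (real (Suc M)))))) \<longlonglongrightarrow> exp (c * of_real (ln (1 + real n * 0)))"
    by (rule tendsto_exp[OF tendsto_mult_left[OF tendsto_of_real]])
  moreover have "exp (c * of_real (ln (1 + real n * inverse (real (Suc M))))) =
      of_nat (Suc (M + n)) powr c / of_nat (Suc M) powr c" for M
  proof -
    have "1 + real n * inverse (real (Suc M)) = real (Suc (M + n)) / real (Suc M)"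
      by (simp add: field_simps)
    then have "ln (1 + real n * inverse (real (Suc M))) = ln (real (Suc (M + n))) - ln (real (Suc M))"
      by (simp add: ln_div del: of_nat_Suc)
    then show ?thesis by (simp add: powr_def exp_diff right_diff_distrib del: of_nat_Suc)
  qed
  ultimately show ?thesis by simp
qed

text \<open>Tannery's theorem. Since Re c \<le> 0, replacing the base \<open>Suc (N - n)\<close> by
  \<open>Suc N\<close> can only decrease the norm of the power, so the bound \<open>K\<close> for
  the normalised \<open>g\<close> yields the majorant \<open>norm (t n) * K\<close> for all
  \<open>N\<close>. In the limit of each fixed \<open>n\<close> the two bases are asymptotically
  equal.\<close>

lemma convolution_limit:
  fixes t g :: "nat \<Rightarrow> complex" and c w :: complex
  assumes t: "summable (\<lambda>n. norm (t n))"
    and g: "(\<lambda>m. g m * of_nat (Suc m) powr c) \<longlonglongrightarrow> w" and c: "Re c \<le> 0"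
  shows "(\<lambda>N. (\<Sum>n\<le>N. t n * g (N - n)) * of_nat (Suc N) powr c) \<longlonglongrightarrow> w * suminf t"
proof -
  define u where "u n N = (if n \<le> N then t n * g (N - n) * of_nat (Suc N) powr c else 0)" for n N
  obtain K where K: "K > 0" "\<And>m. norm (g m * of_nat (Suc m) powr c) \<le> K"
    using convergent_imp_Bseq[OF convergentI[OF g]] by (auto elim: BseqE)
  have norm_powr: "norm (complex_of_nat (Suc m) powr c) = real (Suc m) powr Re c" for m
    using norm_powr_real_powr[of "of_nat (Suc m)" c] by simp
  have lim: "(\<lambda>N. u n N) \<longlonglongrightarrow> t n * w" for n
  proof (rule LIMSEQ_offset[of _ n])
    have "(\<lambda>M. t n * (g M * of_nat (Suc M) powr c) * (of_nat (Suc (M + n)) powr c / of_nat (Suc M) powr c)) \<longlonglongrightarrow> t n * w * 1"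
      by (intro tendsto_mult tendsto_const g of_nat_Suc_powr_ratio)
    moreover have "t n * (g M * of_nat (Suc M) powr c) * (of_nat (Suc (M + n)) powr c / of_nat (Suc M) powr c) = u n (M + n)" for M
      by (simp add: u_def del: of_nat_Suc)
    ultimately show "(\<lambda>M. u n (M + n)) \<longlonglongrightarrow> t n * w" by simp
  qed
  have bound: "norm (u n N) \<le> norm (t n) * K" for n N
  proof (cases "n \<le> N")
    case True
    have "norm (of_nat (Suc N) powr c :: complex) \<le> norm (of_nat (Suc (N - n)) powr c :: complex)"
      unfolding norm_powr using c by (intro powr_mono2') auto
    then have "norm (g (N - n) * of_nat (Suc N) powr c) \<le> norm (g (N - n) * of_nat (Suc (N - n)) powr c)"
      unfolding norm_mult by (intro mult_left_mono) auto
    also have "\<dots> \<le> K" by (rule K)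
    finally have "norm (t n) * norm (g (N - n) * of_nat (Suc N) powr c) \<le> norm (t n) * K"
      by (intro mult_left_mono) auto
    with True show ?thesis by (simp add: u_def norm_mult mult.assoc del: of_nat_Suc)
  qed (use K in \<open>simp add: u_def\<close>)
  have "(\<lambda>N. suminf (\<lambda>n. u n N)) \<longlonglongrightarrow> suminf (\<lambda>n. t n * w)"
  proof -
    have "eventually (\<lambda>(n, N). norm (u n N) \<le> norm (t n) * K) (at_top \<times>\<^sub>F sequentially)"
      using bound by (intro always_eventually) auto
    from tannerys_theorem[of u "\<lambda>n. t n * w", OF lim this summable_mult2[OF t]] show ?thesis by simp
  qed
  moreover have "suminf (\<lambda>n. u n N) = (\<Sum>n\<le>N. t n * g (N - n)) * of_nat (Suc N) powr c" for N
  proof -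
    have "suminf (\<lambda>n. u n N) = (\<Sum>n\<in>{..N}. u n N)"
      by (rule suminf_finite) (auto simp: u_def)
    then show ?thesis by (simp add: u_def sum_distrib_right)
  qed
  moreover have "suminf (\<lambda>n. t n * w) = w * suminf t"
    using suminf_mult2[OF summable_norm_cancel[OF t], of w] by (simp add: mult.commute)
  ultimately show ?thesis by simp
qed

lemma prod_powr_bound:
  fixes h :: "'i \<Rightarrow> nat \<Rightarrow> complex"
  assumes "finite I" "\<And>i. i \<in> I \<Longrightarrow> \<exists>C>0. \<forall>n. norm (h i n) \<le> C * real (Suc n) powr r i"
  shows "\<exists>C>0. \<forall>n. norm (\<Prod>i\<in>I. h i n) \<le> C * real (Suc n) powr (\<Sum>i\<in>I. r i)"
  using assms
proof (induction I)
  case empty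
  then show ?case by (auto intro!: exI[of _ 1])
next
  case (insert i I)
  obtain C where C: "C > 0" "\<And>n. norm (\<Prod>i\<in>I. h i n) \<le> C * real (Suc n) powr (\<Sum>i\<in>I. r i)"
    using insert by auto
  obtain D where D: "D > 0" "\<And>n. norm (h i n) \<le> D * real (Suc n) powr r i"
    using insert.prems[of i] by auto
  have "norm (\<Prod>i\<in>insert i I. h i n) \<le> (D * C) * real (Suc n) powr (\<Sum>i\<in>insert i I. r i)" for n
  proof -
    have "norm (\<Prod>i\<in>insert i I. h i n) = norm (h i n) * norm (\<Prod>i\<in>I. h i n)"
      using insert.hyps by (simp add: norm_mult)
    also have "\<dots> \<le> (D * real (Suc n) powr r i) * (C * real (Suc n) powr (\<Sum>i\<in>I. r i))"
      using C D by (intro mult_mono) (auto simp del: of_nat_Suc)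
    also have "\<dots> = (D * C) * real (Suc n) powr (\<Sum>i\<in>insert i I. r i)"
      using insert.hyps by (simp add: powr_add del: of_nat_Suc)
    finally show ?thesis .
  qed
  then show ?case using C D by (intro exI[of _ "D * C"]) auto
qed

text \<open>Each quotient contributes the exponent Re (a i - b i). The index i = k fits the pattern,
  its denominator being \<open>pochhammer 1 n\<close>; for the others the non-integer differences
  keep the denominator away from 0.\<close>

lemma residue_coeff_bound:
  assumes I: "finite I" "k \<in> I" and a: "\<And>j. j \<in> I \<Longrightarrow> j \<noteq> k \<Longrightarrow> a j - a k \<notin> \<int>"
  shows "\<exists>C>0. \<forall>n. norm (residue_coeff I a b k n) \<le> C * real (Suc n) powr (- Re (\<Sum>i\<in>I. b i - a i))"
proof -
  have "\<exists>C>0. \<forall>n. norm (pochhammer (1 - b i + a k) n / pochhammer (1 - a i + a k) n) \<le> C * real (Suc n) powr (Re (a i) - Re (b i))"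
    if "i \<in> I" for i
  proof -
    have "1 - a i + a k \<notin> \<int>\<^sub>\<le>\<^sub>0"
    proof (cases "i = k")
      case False
      then have "a i - a k \<notin> \<int>" using a that by auto
      then have "1 - (1 - a i + a k) \<notin> \<int>" by simp
      then have "1 - a i + a k \<notin> \<int>" using Ints_diff Ints_1 by blast
      then show ?thesis by auto
    qed simp
    then obtain D where D: "D > 0" "\<And>n. norm (inverse (pochhammer (1 - a i + a k) n)) \<le> D * (real (Suc n) powr (1 - Re (1 - a i + a k)) / fact n)"
      using inverse_pochhammer_bound by blast
    obtain C where C: "C > 0" "\<And>n. norm (pochhammer (1 - b i + a k) n) \<le> C * (fact n * real (Suc n) powr (Re (1 - b i + a k) - 1))"
      using pochhammer_bound by blast
    have "norm (pochhammer (1 - b i + a k) n / pochhammer (1 - a i + a k) n) \<le> C * D * real (Suc n) powr (Re (a i) - Re (b i))" for n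
    proof -
      have "norm (pochhammer (1 - b i + a k) n / pochhammer (1 - a i + a k) n)
         = norm (pochhammer (1 - b i + a k) n) * norm (inverse (pochhammer (1 - a i + a k) n))"
        by (simp add: norm_divide norm_inverse field_simps)
      also have "\<dots> \<le> (C * (fact n * real (Suc n) powr (Re (1 - b i + a k) - 1))) * (D * (real (Suc n) powr (1 - Re (1 - a i + a k)) / fact n))"
        using C D by (intro mult_mono) (auto simp del: of_nat_Suc)
      also have "\<dots> = C * D * (real (Suc n) powr (Re (1 - b i + a k) - 1) * real (Suc n) powr (1 - Re (1 - a i + a k)))"
        by (simp del: of_nat_Suc)
      also have "real (Suc n) powr (Re (1 - b i + a k) - 1) * real (Suc n) powr (1 - Re (1 - a i + a k)) = real (Suc n) powr (Re (a i) - Re (b i))"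
        unfolding powr_add[symmetric] by (rule arg_cong[where f = "\<lambda>x. real (Suc n) powr x"]) simp
      finally show ?thesis .
    qed
    then show ?thesis using C D by (intro exI[of _ "C * D"]) auto
  qed
  then have "\<exists>C>0. \<forall>n. norm (residue_coeff I a b k n) \<le> C * real (Suc n) powr (\<Sum>i\<in>I. Re (a i) - Re (b i))"
    unfolding residue_coeff_def by (intro prod_powr_bound I(1))
  moreover have "(\<Sum>i\<in>I. Re (a i) - Re (b i)) = - Re (\<Sum>i\<in>I. b i - a i)"
    by (simp flip: sum_negf)
  ultimately show ?thesis by simp
qed

text \<open>Up to sign, the residue at s = a k of the product of the Gamma (a i - s) / Gamma (b i -
  s).\<close>

definition residue_weight :: "'i set \<Rightarrow> ('i \<Rightarrow> complex) \<Rightarrow> ('i \<Rightarrow> complex) \<Rightarrow> 'i \<Rightarrow> complex" where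
  "residue_weight I a b k = (\<Prod>i\<in>I. rGamma (b i - a k) * (if i = k then 1 else Gamma (a i - a k)))"

text \<open>Every factor has order m^(b i - a i - 1): the -1 stems from the additional factor of
  \<open>Suc m\<close> in the denominator if i differs from k, and from m! in place of m! m^(-1) if
  i = k. The total exponent is therefore the same for all \<open>k\<close>, and one power of
  \<open>Suc N\<close> normalises all convolutions simultaneously.\<close>

lemma residue_cofactor_asymp:
  assumes I: "finite I" "k \<in> I" and a: "\<And>j. j \<in> I \<Longrightarrow> j \<noteq> k \<Longrightarrow> a j - a k \<notin> \<int>"
  shows "(\<lambda>m. residue_cofactor I a b k m * of_nat (Suc m) powr (of_nat (card I) - (\<Sum>i\<in>I. b i - a i)))
           \<longlonglongrightarrow> residue_weight I a b k"
proof -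
  define h where "h i m = pochhammer (b i - a k) m / (if i = k then fact m else pochhammer (a i - a k) (Suc m))" for i m
  have lim: "(\<lambda>m. h i m * of_nat (Suc m) powr (1 - (b i - a i))) \<longlonglongrightarrow>
      rGamma (b i - a k) * (if i = k then 1 else Gamma (a i - a k))" if i: "i \<in> I" for i
  proof (cases "i = k")
    case True
    have "h i m * of_nat (Suc m) powr (1 - (b i - a i)) = pochhammer (b i - a k) m / pochhammer_scale (b i - a k) m" for m
      using powr_minus[of "complex_of_nat (Suc m)" "b k - a k - 1"]
      by (simp add: True h_def pochhammer_scale_def field_simps del: of_nat_Suc)
    then show ?thesis using True pochhammer_asymp[of "b i - a k"] by simp
  next
    case False
    define \<alpha> \<beta> where "\<alpha> = a i - a k" and "\<beta> = b i - a k"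
    have "\<alpha> \<notin> \<int>" using a[OF i False] by (simp add: \<alpha>_def)
    then have nz: "rGamma \<alpha> \<noteq> 0" by (auto simp: rGamma_eq_zero_iff)
    have "(\<lambda>m. (pochhammer \<beta> m / pochhammer_scale \<beta> m) / ((pochhammer \<alpha> m / pochhammer_scale \<alpha> m) * ((\<alpha> + of_nat m) / of_nat (Suc m))))
       \<longlonglongrightarrow> rGamma \<beta> / (rGamma \<alpha> * 1)"
      by (intro tendsto_divide tendsto_mult pochhammer_asymp LIMSEQ_shift_ratio) (use nz in simp)
    moreover have "(pochhammer \<beta> m / pochhammer_scale \<beta> m) / ((pochhammer \<alpha> m / pochhammer_scale \<alpha> m) * ((\<alpha> + of_nat m) / of_nat (Suc m)))
       = h i m * of_nat (Suc m) powr (1 - (b i - a i))" for m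
    proof -
      have "of_nat (Suc m) powr (1 - (b i - a i)) = of_nat (Suc m) * (of_nat (Suc m) powr (\<alpha> - 1) / of_nat (Suc m) powr (\<beta> - 1) :: complex)"
      proof -
        have "1 - (b i - a i) = 1 + ((\<alpha> - 1) - (\<beta> - 1))" by (simp add: \<alpha>_def \<beta>_def)
        then show ?thesis by (simp only: powr_add powr_diff) (simp del: of_nat_Suc)
      qed
      then show ?thesis using False
        by (simp add: h_def pochhammer_scale_def pochhammer_Suc mult_ac flip: \<alpha>_def \<beta>_def del: of_nat_Suc)
    qed
    ultimately show ?thesis using False by (simp add: \<alpha>_def \<beta>_def Gamma_def field_simps)
  qed
  have "(\<lambda>m. \<Prod>i\<in>I. h i m * of_nat (Suc m) powr (1 - (b i - a i))) \<longlonglongrightarrow> residue_weight I a b k"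
    unfolding residue_weight_def by (rule tendsto_prod) (rule lim)
  moreover have "(\<Prod>i\<in>I. h i m * of_nat (Suc m) powr (1 - (b i - a i))) =
      residue_cofactor I a b k m * of_nat (Suc m) powr (of_nat (card I) - (\<Sum>i\<in>I. b i - a i))" for m
  proof -
    have "(\<Prod>i\<in>I. of_nat (Suc m) powr (1 - (b i - a i))) = (of_nat (Suc m) powr (\<Sum>i\<in>I. 1 - (b i - a i)) :: complex)"
      using I(1) by (induction I) (auto simp: powr_add simp del: of_nat_Suc)
    then show ?thesis unfolding prod.distrib
      by (simp add: residue_cofactor_def h_def sum_subtractf del: of_nat_Suc)
  qed
  ultimately show ?thesis by simp
qed

lemma summable_norm_residue_coeff:
  assumes I: "finite I" "k \<in> I" and a: "\<And>j. j \<in> I \<Longrightarrow> j \<noteq> k \<Longrightarrow> a j - a k \<notin> \<int>"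
    and \<psi>: "Re (\<Sum>i\<in>I. b i - a i) > real e + 1"
  shows "summable (\<lambda>n. norm ((a k + of_nat n) ^ e * residue_coeff I a b k n))"
proof -
  obtain C where C: "C > 0" "\<And>n. norm (residue_coeff I a b k n) \<le> C * real (Suc n) powr (- Re (\<Sum>i\<in>I. b i - a i))"
    using residue_coeff_bound[of I k a b] I a by auto
  have "norm ((a k + of_nat n) ^ e * residue_coeff I a b k n) \<le>
      (norm (a k) + 1) ^ e * C * real (Suc n) powr (real e - Re (\<Sum>i\<in>I. b i - a i))" for n
  proof -
    have "norm (a k + of_nat n) \<le> norm (a k) + real n" by (metis norm_of_nat norm_triangle_ineq)
    also have "\<dots> \<le> (norm (a k) + 1) * real (Suc n)" by (simp add: algebra_simps)
    finally have "norm (a k + of_nat n) ^ e \<le> ((norm (a k) + 1) * real (Suc n)) ^ e"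
      by (intro power_mono) auto
    also have "\<dots> = (norm (a k) + 1) ^ e * real (Suc n) powr real e"
      by (simp add: power_mult_distrib powr_realpow del: of_nat_Suc)
    finally have "norm (a k + of_nat n) ^ e * norm (residue_coeff I a b k n) \<le>
       ((norm (a k) + 1) ^ e * real (Suc n) powr real e) * (C * real (Suc n) powr (- Re (\<Sum>i\<in>I. b i - a i)))"
      using C by (intro mult_mono) (auto simp del: of_nat_Suc)
    also have "\<dots> = (norm (a k) + 1) ^ e * C * (real (Suc n) powr real e * real (Suc n) powr (- Re (\<Sum>i\<in>I. b i - a i)))"
      by simp
    also have "real (Suc n) powr real e * real (Suc n) powr (- Re (\<Sum>i\<in>I. b i - a i)) = real (Suc n) powr (real e - Re (\<Sum>i\<in>I. b i - a i))"
      unfolding powr_add[symmetric] by simp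
    finally show ?thesis by (simp add: norm_mult norm_power del: of_nat_Suc)
  qed
  then have "norm (norm ((a k + of_nat n) ^ e * residue_coeff I a b k n)) \<le>
      (norm (a k) + 1) ^ e * C * real (Suc n) powr (real e - Re (\<Sum>i\<in>I. b i - a i))" for n
    by (simp only: real_norm_def abs_norm_cancel)
  then show ?thesis
  proof (rule summable_comparison_test'[rotated, where N = 0])
    show "summable (\<lambda>n. (norm (a k) + 1) ^ e * C * real (Suc n) powr (real e - Re (\<Sum>i\<in>I. b i - a i)))"
      using \<psi> by (intro summable_mult summable_Suc_powr) linarith
  qed
qed

text \<open>Limit of the normalised finite identities. The lower bound on Re \<psi> serves twice: it
  gives the exponent \<open>?c\<close> a nonpositive real part, as domination requires, and together
  with e + 2 \<le> |I| it makes the residue series converge absolutely.\<close>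

theorem residue_sum_eq_0:
  assumes I: "finite I" and e: "e + 2 \<le> card I"
    and a: "\<And>j k. j \<in> I \<Longrightarrow> k \<in> I \<Longrightarrow> j \<noteq> k \<Longrightarrow> a j - a k \<notin> \<int>"
    and \<psi>: "Re (\<Sum>i\<in>I. b i - a i) \<ge> real (card I)"
  shows "(\<Sum>k\<in>I. residue_weight I a b k * (\<Sum>n. (a k + of_nat n) ^ e * residue_coeff I a b k n)) = 0"
proof -
  let ?c = "of_nat (card I) - (\<Sum>i\<in>I. b i - a i)"
  have "(\<lambda>N. \<Sum>k\<in>I. (\<Sum>n\<le>N. (a k + of_nat n) ^ e * residue_coeff I a b k n * residue_cofactor I a b k (N - n)) * of_nat (Suc N) powr ?c)
     \<longlonglongrightarrow> (\<Sum>k\<in>I. residue_weight I a b k * (\<Sum>n. (a k + of_nat n) ^ e * residue_coeff I a b k n))"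
  proof (intro tendsto_sum convolution_limit)
    fix k assume k: "k \<in> I"
    show "summable (\<lambda>n. norm ((a k + of_nat n) ^ e * residue_coeff I a b k n))"
      using e \<psi> by (intro summable_norm_residue_coeff I k a) auto
    show "(\<lambda>m. residue_cofactor I a b k m * of_nat (Suc m) powr ?c) \<longlonglongrightarrow> residue_weight I a b k"
      by (intro residue_cofactor_asymp I k a)
    show "Re ?c \<le> 0" using \<psi> by simp
  qed
  moreover have "(\<Sum>k\<in>I. (\<Sum>n\<le>N. (a k + of_nat n) ^ e * residue_coeff I a b k n * residue_cofactor I a b k (N - n)) * of_nat (Suc N) powr ?c) = 0" for N
    using residue_convolution[where a = a and b = b and N = N, OF I e a] by (simp flip: sum_distrib_right)
  ultimately show ?thesis by (simp add: LIMSEQ_const_iff)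
qed

section \<open>Contiguous relations\<close>

definition hypergeo_term where
  "hypergeo_term A p q d e n = pochhammer A n * pochhammer p n * pochhammer q n /
          (pochhammer d n * pochhammer e n * fact n)" for A p q d e :: complex

lemma hypergeo_3F2_at_1_eq_suminf: "hypergeo_3F2_at_1 A p q d e = suminf (hypergeo_term A p q d e)"
  by (simp add: hypergeo_3F2_at_1_def hypergeo_term_def[abs_def])

lemma pochhammer_nonzero: "d \<notin> \<int>\<^sub>\<le>\<^sub>0 \<Longrightarrow> pochhammer d n \<noteq> (0 :: complex)"
  by (auto simp: pochhammer_eq_0_iff)

lemma hypergeo_term_bound:
  assumes "d \<notin> \<int>\<^sub>\<le>\<^sub>0" "e \<notin> \<int>\<^sub>\<le>\<^sub>0"
  obtains C where "C > 0" "\<And>n. norm (hypergeo_term A p q d e n) \<le> C * real (Suc n) powr (- Re (d + e - A - p - q) - 1)"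
proof -
  obtain a where a: "a > 0" "\<And>n. norm (pochhammer A n) \<le> a * (fact n * real (Suc n) powr (Re A - 1))"
    using pochhammer_bound by blast
  obtain b where b: "b > 0" "\<And>n. norm (pochhammer p n) \<le> b * (fact n * real (Suc n) powr (Re p - 1))"
    using pochhammer_bound by blast
  obtain c where c: "c > 0" "\<And>n. norm (pochhammer q n) \<le> c * (fact n * real (Suc n) powr (Re q - 1))"
    using pochhammer_bound by blast
  obtain D where D: "D > 0" "\<And>n. norm (inverse (pochhammer d n)) \<le> D * (real (Suc n) powr (1 - Re d) / fact n)"
    using inverse_pochhammer_bound[OF assms(1)] by blast
  obtain E where E: "E > 0" "\<And>n. norm (inverse (pochhammer e n)) \<le> E * (real (Suc n) powr (1 - Re e) / fact n)"
    using inverse_pochhammer_bound[OF assms(2)] by blast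
  have "norm (hypergeo_term A p q d e n) \<le> a * b * c * D * E * real (Suc n) powr (- Re (d + e - A - p - q) - 1)" for n
  proof -
    let ?u = "real (Suc n)"
    have "norm (hypergeo_term A p q d e n) = norm (pochhammer A n) * norm (pochhammer p n) * norm (pochhammer q n)
        * norm (inverse (pochhammer d n)) * norm (inverse (pochhammer e n)) / fact n"
      by (simp add: hypergeo_term_def norm_mult norm_divide norm_inverse norm_fact field_simps)
    also have "\<dots> \<le> (a * (fact n * ?u powr (Re A - 1))) * (b * (fact n * ?u powr (Re p - 1))) * (c * (fact n * ?u powr (Re q - 1)))
       * (D * (?u powr (1 - Re d) / fact n)) * (E * (?u powr (1 - Re e) / fact n)) / fact n"
      using a b c D E by (intro divide_right_mono mult_mono mult_nonneg_nonneg) (auto simp del: of_nat_Suc)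
    also have "\<dots> = a * b * c * D * E * (?u powr (Re A - 1) * ?u powr (Re p - 1) * ?u powr (Re q - 1) * ?u powr (1 - Re d) * ?u powr (1 - Re e))"
      by (simp del: of_nat_Suc)
    also have "?u powr (Re A - 1) * ?u powr (Re p - 1) * ?u powr (Re q - 1) * ?u powr (1 - Re d) * ?u powr (1 - Re e)
       = ?u powr (- Re (d + e - A - p - q) - 1)"
      unfolding powr_add[symmetric] by (rule arg_cong[where f = "\<lambda>x. ?u powr x"]) simp
    finally show ?thesis .
  qed
  moreover have "a * b * c * D * E > 0" using a b c D E by simp
  ultimately show ?thesis using that by blast
qed

lemma summable_hypergeo_term:
  assumes "d \<notin> \<int>\<^sub>\<le>\<^sub>0" "e \<notin> \<int>\<^sub>\<le>\<^sub>0" "Re (d + e - A - p - q) > 0"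
  shows "summable (hypergeo_term A p q d e)"
proof -
  obtain C where C: "\<And>n. norm (hypergeo_term A p q d e n) \<le> C * real (Suc n) powr (- Re (d + e - A - p - q) - 1)"
    using hypergeo_term_bound[OF assms(1,2)] by metis
  show ?thesis
  proof (rule summable_comparison_test'[where N = 0])
    show "summable (\<lambda>n. C * real (Suc n) powr (- Re (d + e - A - p - q) - 1))"
      using assms(3) by (intro summable_mult summable_Suc_powr) simp
  qed (use C in simp)
qed

lemma nonpos_Ints_plus_1: "d \<notin> \<int>\<^sub>\<le>\<^sub>0 \<Longrightarrow> d + 1 \<notin> \<int>\<^sub>\<le>\<^sub>0" for d :: complex
proof
  assume d: "d \<notin> \<int>\<^sub>\<le>\<^sub>0" and "d + 1 \<in> \<int>\<^sub>\<le>\<^sub>0"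
  then obtain n where "d + 1 = - of_nat n" by (auto elim!: nonpos_Ints_cases')
  then have "d = - of_nat (Suc n)" by (simp add: algebra_simps eq_neg_iff_add_eq_0)
  moreover have "- of_nat (Suc n) \<in> (\<int>\<^sub>\<le>\<^sub>0 :: complex set)" by (rule minus_of_nat_in_nonpos_Ints)
  ultimately show False using d by metis
qed

text \<open>Holds term by term: raising \<open>d\<close> costs a factor d + n, which is split as (A
  + n) + (d - A), and the part A + n is absorbed by raising \<open>A\<close>.\<close>

lemma hypergeo_contiguous_upper_lower:
  assumes d: "d \<notin> \<int>\<^sub>\<le>\<^sub>0" and e: "e \<notin> \<int>\<^sub>\<le>\<^sub>0" and s: "Re (d + e - A - p - q) > 0"
  shows "d * hypergeo_3F2_at_1 A p q d e =
     A * hypergeo_3F2_at_1 (A + 1) p q (d + 1) e + (d - A) * hypergeo_3F2_at_1 A p q (d + 1) e"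
proof -
  note d1 = nonpos_Ints_plus_1[OF d]
  have eq: "d * hypergeo_term A p q d e n =
     A * hypergeo_term (A + 1) p q (d + 1) e n + (d - A) * hypergeo_term A p q (d + 1) e n" for n
  proof -
    have nz: "d \<noteq> 0" "pochhammer d n \<noteq> 0" "pochhammer (d + 1) n \<noteq> 0" "pochhammer e n \<noteq> 0"
      using d d1 e pochhammer_nonzero by auto
    have "d * pochhammer (d + 1) n = pochhammer d n * (d + of_nat n)"
      by (metis pochhammer_Suc pochhammer_rec)
    then have D: "d / pochhammer d n = (d + of_nat n) / pochhammer (d + 1) n"
      using nz by (simp add: field_simps)
    have A: "A * pochhammer (A + 1) n = pochhammer A n * (A + of_nat n)"
      by (metis pochhammer_Suc pochhammer_rec)
    have "d * hypergeo_term A p q d e n = (d / pochhammer d n) * (pochhammer A n * pochhammer p n * pochhammer q n / (pochhammer e n * fact n))"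
      by (simp add: hypergeo_term_def)
    also have "\<dots> = (pochhammer A n * (A + of_nat n) + (d - A) * pochhammer A n) * pochhammer p n * pochhammer q n / (pochhammer (d + 1) n * pochhammer e n * fact n)"
      unfolding D by (simp add: algebra_simps add_divide_distrib)
    also have "\<dots> = A * hypergeo_term (A + 1) p q (d + 1) e n + (d - A) * hypergeo_term A p q (d + 1) e n"
      unfolding A[symmetric] hypergeo_term_def by (simp add: algebra_simps add_divide_distrib diff_divide_distrib)
    finally show ?thesis .
  qed
  have "(\<lambda>n. d * hypergeo_term A p q d e n) sums (d * suminf (hypergeo_term A p q d e))"
    by (intro sums_mult summable_sums summable_hypergeo_term d e s)
  moreover have "(\<lambda>n. d * hypergeo_term A p q d e n) sums
      (A * suminf (hypergeo_term (A + 1) p q (d + 1) e) + (d - A) * suminf (hypergeo_term A p q (d + 1) e))"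
    unfolding eq using s by (intro sums_add sums_mult summable_sums summable_hypergeo_term d1 e) (auto simp: algebra_simps)
  ultimately show ?thesis unfolding hypergeo_3F2_at_1_eq_suminf by (rule sums_unique2)
qed

text \<open>Recurrence in \<open>A\<close> special to argument 1. The convergence hypothesis is that
  of the series with A + 1, the slowest of the three; it also makes the boundary term, of order n^2
  times a summand, tend to 0.\<close>

lemma hypergeo_contiguous_upper:
  fixes A p q d e :: complex
  defines "c1 \<equiv> (A - 1) * (d - A) * (e - A) + (p - A) * (q - A) - A * (d - A - 1) * (e - A - 1)"
    and "c2 \<equiv> A + 1 + p + q - d - e"
  assumes d: "d \<notin> \<int>\<^sub>\<le>\<^sub>0" and e: "e \<notin> \<int>\<^sub>\<le>\<^sub>0" and s: "Re (d + e - (A + 1) - p - q) > 0"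
  shows "(d - A) * (e - A) * hypergeo_3F2_at_1 (A - 1) p q d e + c1 * hypergeo_3F2_at_1 A p q d e
     + c2 * A * hypergeo_3F2_at_1 (A + 1) p q d e = 0"
proof -
  \<comment> \<open>Zeilberger certificate of the recurrence\<close>
  define R where "R n = (p + of_nat n) * (q + of_nat n) * hypergeo_term A p q d e n" for n
  \<comment> \<open>As a multiple of the n-th summand the certificate is n (d + n - 1) (e + n - 1) /
    (A + n - 1). Going through the preceding summand avoids this denominator, which may
    vanish.\<close>
  define r where "r n = (case n of 0 \<Rightarrow> 0 | Suc m \<Rightarrow> R m)" for n
  obtain C where C: "C > 0" "\<And>n. norm (hypergeo_term A p q d e n) \<le> C * real (Suc n) powr (- Re (d + e - A - p - q) - 1)"
    using hypergeo_term_bound[OF d e] by metis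
  have "R \<longlonglongrightarrow> 0"
  proof -
    have "(\<lambda>n. ((p + of_nat n) / of_nat (Suc n)) * ((q + of_nat n) / of_nat (Suc n))
        * (of_nat (Suc n) ^ 2 * hypergeo_term A p q d e n)) \<longlonglongrightarrow> 1 * 1 * 0"
    proof (intro tendsto_mult LIMSEQ_shift_ratio tendsto_zero_powr_bound)
      show "- Re (d + e - (A + 1) - p - q) < 0" using s by simp
      fix n
      have "norm (of_nat (Suc n) ^ 2 * hypergeo_term A p q d e n) \<le> real (Suc n) powr 2 * (C * real (Suc n) powr (- Re (d + e - A - p - q) - 1))"
        unfolding norm_mult norm_power norm_of_nat using C(2)[of n]
        by (intro mult_mono) (simp_all del: of_nat_Suc)
      also have "\<dots> = C * (real (Suc n) powr 2 * real (Suc n) powr (- Re (d + e - A - p - q) - 1))" by simp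
      also have "real (Suc n) powr 2 * real (Suc n) powr (- Re (d + e - A - p - q) - 1) = real (Suc n) powr (- Re (d + e - (A + 1) - p - q))"
        unfolding powr_add[symmetric] by (rule arg_cong[where f = "\<lambda>x. real (Suc n) powr x"]) simp
      finally show "norm (of_nat (Suc n) ^ 2 * hypergeo_term A p q d e n) \<le> C * real (Suc n) powr (- Re (d + e - (A + 1) - p - q))" .
    qed
    moreover have "((p + of_nat n) / of_nat (Suc n)) * ((q + of_nat n) / of_nat (Suc n))
        * (of_nat (Suc n) ^ 2 * hypergeo_term A p q d e n) = R n" for n
      using of_nat_neq_0[of n, where 'a = complex] by (simp add: R_def power2_eq_square del: of_nat_Suc)
    ultimately show ?thesis by simp
  qed
  then have "(\<lambda>n. r (Suc n)) \<longlonglongrightarrow> 0" by (simp add: r_def)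
  then have "r \<longlonglongrightarrow> 0" by (rule LIMSEQ_imp_Suc)
  then have "(\<lambda>n. r (Suc n) - r n) sums (0 - r 0)" by (rule telescope_sums)
  moreover have "r (Suc n) - r n = (d - A) * (e - A) * hypergeo_term (A - 1) p q d e n + c1 * hypergeo_term A p q d e n
     + c2 * A * hypergeo_term (A + 1) p q d e n" for n
  proof (cases n)
    case 0
    then show ?thesis by (simp add: r_def R_def hypergeo_term_def c1_def c2_def algebra_simps)
  next
    case (Suc k)
    \<comment> \<open>The common factor has one Pochhammer factor of \<open>A\<close> less than the
      n-th summand. All quantities are then polynomial multiples of \<open>h\<close>, and the claim
      becomes a polynomial identity without division by A + k.\<close>
    define h where "h = pochhammer A k * pochhammer p (Suc k) * pochhammer q (Suc k) / (pochhammer d (Suc k) * pochhammer e (Suc k) * fact (Suc k))"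
    define K where "K = (of_nat k :: complex)"
    have Am: "pochhammer (A - 1) (Suc k) = (A - 1) * pochhammer A k"
      by (simp add: pochhammer_rec)
    have A0: "pochhammer A (Suc k) = (A + K) * pochhammer A k"
      by (simp add: pochhammer_Suc K_def)
    have "A * pochhammer (A + 1) (Suc k) = pochhammer A (Suc (Suc k))"
      by (simp add: pochhammer_rec)
    then have Ap: "A * pochhammer (A + 1) (Suc k) = (A + K + 1) * ((A + K) * pochhammer A k)"
      by (simp add: pochhammer_Suc K_def algebra_simps)
    have t1: "hypergeo_term (A - 1) p q d e n = (A - 1) * h"
      unfolding hypergeo_term_def Suc Am h_def by simp
    have t2: "hypergeo_term A p q d e n = (A + K) * h"
      unfolding hypergeo_term_def Suc A0 h_def by simp
    have "A * hypergeo_term (A + 1) p q d e n = (A * pochhammer (A + 1) (Suc k)) * pochhammer p (Suc k) * pochhammer q (Suc k) / (pochhammer d (Suc k) * pochhammer e (Suc k) * fact (Suc k))"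
      unfolding hypergeo_term_def Suc by simp
    then have t3: "A * hypergeo_term (A + 1) p q d e n = (A + K + 1) * (A + K) * h"
      unfolding Ap h_def by simp
    have r1: "r (Suc n) = (p + K + 1) * (q + K + 1) * (A + K) * h"
      by (simp add: r_def R_def t2[unfolded Suc] Suc K_def algebra_simps)
    have nz: "pochhammer d k \<noteq> 0" "pochhammer e k \<noteq> 0" "d + K \<noteq> 0" "e + K \<noteq> 0" "K + 1 \<noteq> 0"
      using pochhammer_nonzero[OF d, of "Suc k"] pochhammer_nonzero[OF e, of "Suc k"] of_nat_neq_0[of k, where 'a = complex]
      by (auto simp: pochhammer_Suc K_def add_ac)
    have "hypergeo_term A p q d e k * ((p + K) * (q + K)) = (K + 1) * (d + K) * (e + K) * h"
      using nz unfolding hypergeo_term_def h_def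
      by (simp add: pochhammer_Suc fact_Suc K_def[symmetric] divide_simps add.commute)
    then have r0: "r n = (K + 1) * (d + K) * (e + K) * h"
      by (simp add: r_def R_def Suc K_def mult_ac)
    have "(d - A) * (e - A) * ((A - 1) * h) + c1 * ((A + K) * h) + c2 * ((A + K + 1) * (A + K) * h) =
       (p + K + 1) * (q + K + 1) * (A + K) * h - (K + 1) * (d + K) * (e + K) * h"
      unfolding c1_def c2_def by (simp add: algebra_simps)
    then show ?thesis unfolding t1 t2 r1 r0 mult.assoc[of c2 A] t3 by simp
  qed
  moreover have "r 0 = 0" by (simp add: r_def)
  ultimately have "(\<lambda>n. (d - A) * (e - A) * hypergeo_term (A - 1) p q d e n + c1 * hypergeo_term A p q d e n
     + c2 * A * hypergeo_term (A + 1) p q d e n) sums 0" by simp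
  moreover have "(\<lambda>n. (d - A) * (e - A) * hypergeo_term (A - 1) p q d e n + c1 * hypergeo_term A p q d e n
     + c2 * A * hypergeo_term (A + 1) p q d e n) sums
      ((d - A) * (e - A) * suminf (hypergeo_term (A - 1) p q d e) + c1 * suminf (hypergeo_term A p q d e)
     + c2 * A * suminf (hypergeo_term (A + 1) p q d e))"
    using s by (intro sums_add sums_mult summable_sums summable_hypergeo_term d e) auto
  ultimately show ?thesis unfolding hypergeo_3F2_at_1_eq_suminf by (rule sums_unique2[symmetric])
qed

section \<open>Connection terms\<close>

text \<open>With \<open>(x, y, z) = (b\<^sub>i, b\<^sub>j\<^sub>1, b\<^sub>j\<^sub>2)\<close> and \<open>(\<alpha>, \<beta>, \<delta>) = (a\<^sub>k, a\<^sub>k\<^sub>1, a\<^sub>k\<^sub>2)\<close> the weight is \<open>T\<^sub>k / \<pi>\<^sup>2\<close>, rewritten by the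
  reflection formula so that it stays meaningful when \<open>z\<close> is shifted to a pole of \<open>\<Gamma>(1 - z + \<alpha>)\<close>.\<close>

definition connection_weight :: "complex \<Rightarrow> complex \<Rightarrow> complex \<Rightarrow> complex \<Rightarrow> complex \<Rightarrow> complex \<Rightarrow> complex" where
  "connection_weight x y z \<alpha> \<beta> \<delta> = (let \<psi> = x + y + z - \<alpha> - \<beta> - \<delta> in
     sin (of_real pi * (x - \<alpha>)) / (sin (of_real pi * (\<beta> - \<alpha>)) * sin (of_real pi * (\<delta> - \<alpha>))) *
     (rGamma (y - \<alpha>) * rGamma (z - \<alpha>)) * (rGamma (\<psi> - y + \<alpha>) * rGamma (\<psi> - z + \<alpha>)))"

definition connection_term0 :: "complex \<Rightarrow> complex \<Rightarrow> complex \<Rightarrow> complex \<Rightarrow> complex \<Rightarrow> complex \<Rightarrow> complex" where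
  "connection_term0 x y z \<alpha> \<beta> \<delta> = (let \<psi> = x + y + z - \<alpha> - \<beta> - \<delta> in
     connection_weight x y z \<alpha> \<beta> \<delta> *
     hypergeo_3F2_at_1 (\<psi> - 1) (x - \<beta>) (x - \<delta>) (\<psi> - y + \<alpha>) (\<psi> - z + \<alpha>))"

definition connection_term1 :: "complex \<Rightarrow> complex \<Rightarrow> complex \<Rightarrow> complex \<Rightarrow> complex \<Rightarrow> complex \<Rightarrow> complex" where
  "connection_term1 x y z \<alpha> \<beta> \<delta> = (let \<psi> = x + y + z - \<alpha> - \<beta> - \<delta> in
     connection_weight x y z \<alpha> \<beta> \<delta> *
     ((1 - y + \<alpha>) * (1 - z + \<alpha>) *
        hypergeo_3F2_at_1 (\<psi> - 2) (x - \<beta>) (x - \<delta>) (\<psi> - y + \<alpha>) (\<psi> - z + \<alpha>)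
      - \<alpha> * (2 - \<psi>) *
        hypergeo_3F2_at_1 (\<psi> - 1) (x - \<beta>) (x - \<delta>) (\<psi> - y + \<alpha>) (\<psi> - z + \<alpha>)))"

text \<open>Passing to z + 1 raises \<psi> and d' by 1 and fixes e', p and q. Two relations raising
  d' rewrite the series at \<open>z\<close> through \<open>F1\<close>, \<open>F0\<close> and
  \<open>Fm\<close>; the recurrence in \<open>A\<close> eliminates \<open>Fm\<close>, and the terms
  at z + 1 are combinations of the remaining two. All convergence conditions reduce to Re (1 +
  \<alpha> - x) > 0 or weaker, whatever \<open>z\<close> is.\<close>

lemma connection_term_shift:
  fixes x y z \<alpha> \<beta> \<delta> :: complex
  defines "\<psi> \<equiv> x + y + z - \<alpha> - \<beta> - \<delta>"
  assumes d: "\<psi> - y + \<alpha> \<notin> \<int>\<^sub>\<le>\<^sub>0" and e: "\<psi> - z + \<alpha> \<notin> \<int>\<^sub>\<le>\<^sub>0" and x: "Re x < Re (\<alpha> + 1)"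
  shows "connection_term0 x y z \<alpha> \<beta> \<delta> =
      z * (\<psi> - 1) * connection_term0 x y (z + 1) \<alpha> \<beta> \<delta> - connection_term1 x y (z + 1) \<alpha> \<beta> \<delta>"
    and "connection_term1 x y z \<alpha> \<beta> \<delta> =
      (\<psi> - 1) * (z * (1 - x) * (1 - y) - \<alpha> * \<beta> * \<delta>) * connection_term0 x y (z + 1) \<alpha> \<beta> \<delta>
      + (z * (\<psi> - 2) - (1 - x) * (1 - y) + z * (1 - x) + z * (1 - y) + (\<alpha> * \<beta> + \<alpha> * \<delta> + \<beta> * \<delta>))
        * connection_term1 x y (z + 1) \<alpha> \<beta> \<delta>"
proof -
  define A p q d' e' where "A = \<psi> - 1" and "p = x - \<beta>" and "q = x - \<delta>"
    and "d' = \<psi> - y + \<alpha>" and "e' = \<psi> - z + \<alpha>"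
  note defs = A_def p_def q_def d'_def e'_def \<psi>_def
  define F1 where "F1 = hypergeo_3F2_at_1 (A + 1) p q (d' + 1) e'"
  define F0 where "F0 = hypergeo_3F2_at_1 A p q (d' + 1) e'"
  define Fm where "Fm = hypergeo_3F2_at_1 (A - 1) p q (d' + 1) e'"
  define G0 where "G0 = hypergeo_3F2_at_1 A p q d' e'"
  define Gm where "Gm = hypergeo_3F2_at_1 (A - 1) p q d' e'"
  define c1 where "c1 = (A - 1) * (d' + 1 - A) * (e' - A) + (p - A) * (q - A) - A * (d' + 1 - A - 1) * (e' - A - 1)"
  define c2 where "c2 = A + 1 + p + q - (d' + 1) - e'"
  define W where "W = connection_weight x y (z + 1) \<alpha> \<beta> \<delta>"
  have d': "d' \<notin> \<int>\<^sub>\<le>\<^sub>0" and e': "e' \<notin> \<int>\<^sub>\<le>\<^sub>0" using d e by (auto simp: d'_def e'_def)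
  have con1: "d' * G0 = A * F1 + (d' - A) * F0"
    unfolding G0_def F1_def F0_def using x
    by (intro hypergeo_contiguous_upper_lower d' e') (simp add: defs)
  have con2: "d' * Gm = (A - 1) * F0 + (d' - A + 1) * Fm"
    using hypergeo_contiguous_upper_lower[OF d' e', of "A - 1" p q] x
    unfolding Gm_def F0_def Fm_def by (simp add: defs algebra_simps)
  have con3: "(d' + 1 - A) * (e' - A) * Fm + c1 * F0 + c2 * A * F1 = 0"
    unfolding Fm_def F0_def F1_def c1_def c2_def using x
    by (intro hypergeo_contiguous_upper nonpos_Ints_plus_1 d' e') (simp add: defs)
  \<comment> \<open>Only two reciprocal Gamma values change. The resulting factor z - \<alpha> is
    what pairs with 1 - (z + 1) + \<alpha> = \<alpha> - z in \<open>connection_term1\<close> at z +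
    1.\<close>
  have W: "connection_weight x y z \<alpha> \<beta> \<delta> = W * ((z - \<alpha>) * d')"
  proof -
    have 1: "rGamma (z - \<alpha>) = (z - \<alpha>) * rGamma (z + 1 - \<alpha>)"
      using rGamma_plus1[of "z - \<alpha>"] by (simp add: algebra_simps)
    have 2: "rGamma d' = d' * rGamma (d' + 1)" by (rule rGamma_plus1[symmetric])
    have 3: "x + y + (z + 1) - \<alpha> - \<beta> - \<delta> = \<psi> + 1" "\<psi> + 1 - y + \<alpha> = d' + 1" "\<psi> + 1 - (z + 1) + \<alpha> = e'"
      by (simp_all add: d'_def e'_def \<psi>_def)
    show ?thesis
      unfolding W_def connection_weight_def Let_def 3
      unfolding \<psi>_def[symmetric] d'_def[symmetric] e'_def[symmetric] 1 2 by (simp add: mult_ac)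
  qed
  have t0: "connection_term0 x y z \<alpha> \<beta> \<delta> = W * (z - \<alpha>) * (d' * G0)"
    unfolding connection_term0_def Let_def W by (simp add: G0_def defs)
  have t1: "connection_term1 x y z \<alpha> \<beta> \<delta> =
      W * (z - \<alpha>) * ((d' - A) * (e' - A) * (d' * Gm) + \<alpha> * (A - 1) * (d' * G0))"
  proof -
    have 1: "1 - y + \<alpha> = d' - A" "1 - z + \<alpha> = e' - A" "2 - \<psi> = - (A - 1)" "\<psi> - 2 = A - 1" "\<psi> - 1 = A"
      by (simp_all add: A_def d'_def e'_def)
    show ?thesis
      unfolding connection_term1_def Let_def W Gm_def G0_def
      unfolding \<psi>_def[symmetric] p_def[symmetric] q_def[symmetric] d'_def[symmetric] e'_def[symmetric] 1
      by (simp add: algebra_simps)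
  qed
  have u0: "connection_term0 x y (z + 1) \<alpha> \<beta> \<delta> = W * F1"
    unfolding connection_term0_def Let_def W_def F1_def by (simp add: defs algebra_simps)
  have u1: "connection_term1 x y (z + 1) \<alpha> \<beta> \<delta> = W * ((d' - A) * (\<alpha> - z) * F0 + \<alpha> * A * F1)"
  proof -
    have 1: "x + y + (z + 1) - \<alpha> - \<beta> - \<delta> = \<psi> + 1" by (simp add: \<psi>_def)
    have 2: "\<psi> + 1 - 2 = A" "\<psi> + 1 - 1 = A + 1" "\<psi> + 1 - y + \<alpha> = d' + 1" "\<psi> + 1 - (z + 1) + \<alpha> = e'"
      "1 - y + \<alpha> = d' - A" "1 - (z + 1) + \<alpha> = \<alpha> - z" "2 - (\<psi> + 1) = - A"
      by (simp_all add: A_def d'_def e'_def)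
    show ?thesis
      unfolding connection_term1_def Let_def W_def F1_def F0_def 1
      unfolding 2 p_def[symmetric] q_def[symmetric] by simp
  qed
  show "connection_term0 x y z \<alpha> \<beta> \<delta> =
      z * (\<psi> - 1) * connection_term0 x y (z + 1) \<alpha> \<beta> \<delta> - connection_term1 x y (z + 1) \<alpha> \<beta> \<delta>"
    unfolding t0 u0 u1 con1 A_def[symmetric] by (simp add: algebra_simps)
  define Y where "Y = z * (\<psi> - 2) - (1 - x) * (1 - y) + z * (1 - x) + z * (1 - y) + (\<alpha> * \<beta> + \<alpha> * \<delta> + \<beta> * \<delta>)"
  define P where "P = z * (1 - x) * (1 - y) - \<alpha> * \<beta> * \<delta>"
  \<comment> \<open>In this identity and the next one the special role of \<alpha> disappears:
    \<open>Y\<close> and \<open>P\<close> are symmetric in \<alpha>, \<beta>, \<delta>, and the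
    leftover \<alpha> times \<open>Y\<close> is just the \<alpha>-part of
    \<open>connection_term1\<close> at z + 1.\<close>
  have Y: "(e' - A) * (A - 1) - c1 + \<alpha> * (A - 1) = - Y"
    unfolding Y_def c1_def defs by (simp add: algebra_simps)
  have P: "(z - \<alpha>) * (\<alpha> * (A - 1) - (d' - A) * c2) = P + \<alpha> * Y"
    unfolding Y_def P_def c2_def defs by (simp add: algebra_simps)
  have "(d' - A) * (e' - A) * (d' * Gm) = (d' - A) * ((e' - A) * (A - 1) * F0 + (d' + 1 - A) * (e' - A) * Fm)"
    unfolding con2 by (simp add: algebra_simps)
  also have "(d' + 1 - A) * (e' - A) * Fm = - (c1 * F0 + c2 * A * F1)"
    using con3 unfolding add.assoc by (rule eq_neg_iff_add_eq_0[THEN iffD2])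
  finally have "connection_term1 x y z \<alpha> \<beta> \<delta> = W * (z - \<alpha>) *
      ((d' - A) * ((e' - A) * (A - 1) * F0 + - (c1 * F0 + c2 * A * F1)) + \<alpha> * (A - 1) * (A * F1 + (d' - A) * F0))"
    unfolding t1 con1 by simp
  also have "\<dots> = W * ((z - \<alpha>) * (d' - A) * ((e' - A) * (A - 1) - c1 + \<alpha> * (A - 1)) * F0
       + ((z - \<alpha>) * (\<alpha> * (A - 1) - (d' - A) * c2)) * A * F1)"
    by (simp add: algebra_simps)
  also have "\<dots> = A * P * (W * F1) + Y * (W * ((d' - A) * (\<alpha> - z) * F0 + \<alpha> * A * F1))"
    unfolding Y P by (simp add: algebra_simps)
  finally show "connection_term1 x y z \<alpha> \<beta> \<delta> =
      (\<psi> - 1) * (z * (1 - x) * (1 - y) - \<alpha> * \<beta> * \<delta>) * connection_term0 x y (z + 1) \<alpha> \<beta> \<delta>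
      + (z * (\<psi> - 2) - (1 - x) * (1 - y) + z * (1 - x) + z * (1 - y) + (\<alpha> * \<beta> + \<alpha> * \<delta> + \<beta> * \<delta>))
        * connection_term1 x y (z + 1) \<alpha> \<beta> \<delta>"
    unfolding u0 u1 Y_def P_def A_def .
qed

section \<open>Connection terms as residue series for large Re \<psi>\<close>

lemma rGamma_mult_hypergeo:
  assumes d: "d \<notin> \<int>\<^sub>\<le>\<^sub>0" and e: "e \<notin> \<int>\<^sub>\<le>\<^sub>0" and s: "Re (d + e - A - p - q) > 0"
  shows "rGamma d * rGamma e * hypergeo_3F2_at_1 A p q d e =
    (\<Sum>n. pochhammer A n * pochhammer p n * pochhammer q n / fact n * (rGamma (d + of_nat n) * rGamma (e + of_nat n)))"
proof -
  have "rGamma d * rGamma e * hypergeo_3F2_at_1 A p q d e = (\<Sum>n. rGamma d * rGamma e * hypergeo_term A p q d e n)"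
    unfolding hypergeo_3F2_at_1_eq_suminf by (rule suminf_mult[OF summable_hypergeo_term[OF d e s], symmetric])
  moreover have "rGamma d * rGamma e * hypergeo_term A p q d e n =
      pochhammer A n * pochhammer p n * pochhammer q n / fact n * (rGamma (d + of_nat n) * rGamma (e + of_nat n))" for n
    unfolding pochhammer_rGamma[of d n] pochhammer_rGamma[of e n]
    using pochhammer_nonzero[OF d, of n] pochhammer_nonzero[OF e, of n] by (simp add: hypergeo_term_def)
  ultimately show ?thesis by simp
qed

text \<open>Here \<open>w\<close> and \<open>f\<close> are \<open>residue_weight\<close> and
  \<open>residue_coeff\<close> for three indices. Thomae's transformation with A = \<psi> - 1 gives
  the series over \<open>f\<close>; with \<psi> - 2 it gives a series shifted by one index, in which
  the factor (1 - y + \<alpha>) (1 - z + \<alpha>) restores the weight \<open>n\<close>. Adding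
  \<alpha> times the first series completes \<open>n\<close> to \<alpha> + n. The remaining
  prefactors depend only on \<psi>.\<close>

lemma connection_term_eq_residue_sum:
  fixes x y z \<alpha> \<beta> \<delta> :: complex
  defines "\<psi> \<equiv> x + y + z - \<alpha> - \<beta> - \<delta>"
    and "w \<equiv> rGamma (x - \<alpha>) * rGamma (y - \<alpha>) * rGamma (z - \<alpha>) * Gamma (\<beta> - \<alpha>) * Gamma (\<delta> - \<alpha>)"
    and "f \<equiv> \<lambda>n. pochhammer (1 - x + \<alpha>) n * pochhammer (1 - y + \<alpha>) n * pochhammer (1 - z + \<alpha>) n /
             (fact n * pochhammer (1 - \<beta> + \<alpha>) n * pochhammer (1 - \<delta> + \<alpha>) n)"
  assumes d: "\<psi> - y + \<alpha> \<notin> \<int>\<^sub>\<le>\<^sub>0" and e: "\<psi> - z + \<alpha> \<notin> \<int>\<^sub>\<le>\<^sub>0" and x: "Re x < Re (\<alpha> + 1)"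
    and \<beta>: "\<beta> - \<alpha> \<notin> \<int>" and \<delta>: "\<delta> - \<alpha> \<notin> \<int>"
    and big: "Re \<psi> > 5 + 2 * \<bar>Re (x + 1 + \<alpha> - \<beta> - \<delta>)\<bar>"
    and summable_f: "summable f" and summable_nf: "summable (\<lambda>n. (\<alpha> + of_nat n) * f n)"
  shows "connection_term0 x y z \<alpha> \<beta> \<delta> = rGamma (\<psi> - 1) / of_real pi * (w * (\<Sum>n. f n))"
    and "connection_term1 x y z \<alpha> \<beta> \<delta> = rGamma (\<psi> - 2) / of_real pi * (w * (\<Sum>n. (\<alpha> + of_nat n) * f n))"
proof -
  define A p q d' e' where "A = \<psi> - 1" and "p = x - \<beta>" and "q = x - \<delta>"
    and "d' = \<psi> - y + \<alpha>" and "e' = \<psi> - z + \<alpha>"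
  note defs = A_def p_def q_def d'_def e'_def \<psi>_def
  define s where "s = 1 + \<alpha> - x"
  define V where "V = sin (of_real pi * (x - \<alpha>)) / (sin (of_real pi * (\<beta> - \<alpha>)) * sin (of_real pi * (\<delta> - \<alpha>))) *
     (rGamma (y - \<alpha>) * rGamma (z - \<alpha>))"
  define \<kappa> where "\<kappa> = Gamma s * rGamma (1 + \<alpha> - \<beta>) * rGamma (1 + \<alpha> - \<delta>)"
  define G where "G n = pochhammer (1 - y + \<alpha>) n * pochhammer (1 - z + \<alpha>) n / fact n *
        (Gamma (s + of_nat n) * rGamma (1 + \<alpha> - \<beta> + of_nat n) * rGamma (1 + \<alpha> - \<delta> + of_nat n))" for n
  have d': "d' \<notin> \<int>\<^sub>\<le>\<^sub>0" and e': "e' \<notin> \<int>\<^sub>\<le>\<^sub>0" using d e by (auto simp: d'_def e'_def)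
  \<comment> \<open>These are the two instances of \<open>big\<close> in Thomae's transformation,
    with \<open>r\<close> = Re \<psi> and \<open>g\<close> = Re (d' + e' - A), which does not
    involve y or z.\<close>
  have abs_bound: "g + \<bar>1 - g\<bar> - (r - 1) < 1" "g + 1 + \<bar>g\<bar> - (r - 2) < 1" if "r > 5 + 2 * \<bar>g\<bar>" for g r :: real
    using that by (auto simp: abs_if split: if_splits)
  have psi5: "Re \<psi> > 5" using big abs_ge_zero[of "Re (x + 1 + \<alpha> - \<beta> - \<delta>)"] by linarith
  have s: "Re s > 0" using x by (simp add: s_def)
  have s': "s \<notin> \<int>\<^sub>\<le>\<^sub>0" using s nonpos_Ints_Re_le[of s] by auto
  have nonint: "1 + \<alpha> - \<gamma> \<notin> \<int>" if "\<gamma> - \<alpha> \<notin> \<int>" for \<gamma>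
  proof
    assume "1 + \<alpha> - \<gamma> \<in> \<int>"
    from Ints_diff[OF Ints_1 this] that show False by simp
  qed
  have G_eq: "G n = \<kappa> * f n" for n
  proof -
    have 1: "Gamma (s + of_nat n) = pochhammer s n * Gamma s"
      using pochhammer_Gamma[OF s', of n] Gamma_eq_zero_iff[of s] s' by (simp add: field_simps)
    have 2: "rGamma (1 + \<alpha> - \<gamma> + of_nat n) = rGamma (1 + \<alpha> - \<gamma>) / pochhammer (1 + \<alpha> - \<gamma>) n"
      if "\<gamma> - \<alpha> \<notin> \<int>" for \<gamma>
      using pochhammer_rGamma[of "1 + \<alpha> - \<gamma>" n] pochhammer_nonzero[of "1 + \<alpha> - \<gamma>" n] nonint[OF that] by auto
    have 3: "1 - x + \<alpha> = s" "1 - \<beta> + \<alpha> = 1 + \<alpha> - \<beta>" "1 - \<delta> + \<alpha> = 1 + \<alpha> - \<delta>" by (simp_all add: s_def)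
    show ?thesis unfolding G_def f_def \<kappa>_def 1 2[OF \<beta>] 2[OF \<delta>] 3 by (simp add: mult_ac)
  qed
  have thomae0: "rGamma d' * rGamma e' * hypergeo_3F2_at_1 A p q d' e' = rGamma A * suminf G"
  proof -
    have eqs: "d' + e' - A - p - q = s" "d' + e' - A = x + 1 + \<alpha> - \<beta> - \<delta>"
      "s + p = 1 + \<alpha> - \<beta>" "s + q = 1 + \<alpha> - \<delta>" "d' - A = 1 - y + \<alpha>" "e' - A = 1 - z + \<alpha>"
      by (simp_all add: s_def defs)
    have "Re A > 0" using psi5 by (simp add: A_def)
    moreover have "Re (x + 1 + \<alpha> - \<beta> - \<delta>) + \<bar>1 - Re (x + 1 + \<alpha> - \<beta> - \<delta>)\<bar> - Re A < 1"
      using abs_bound(1)[OF big] by (simp add: A_def)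
    ultimately show ?thesis unfolding G_def
      using s rGamma_mult_hypergeo[OF d' e', of A p q] thomae_transformation[of A d' e' p q]
      unfolding eqs(1) unfolding eqs(2-) by simp
  qed
  have thomae1: "(1 - y + \<alpha>) * (1 - z + \<alpha>) * (rGamma d' * rGamma e' * hypergeo_3F2_at_1 (A - 1) p q d' e')
      = rGamma (A - 1) * (\<Sum>n. of_nat n * G n)"
  proof -
    have eqs: "d' + e' - (A - 1) - p - q = s + 1" "d' + e' - (A - 1) = x + 1 + \<alpha> - \<beta> - \<delta> + 1"
      "s + 1 + p = 1 + \<alpha> - \<beta> + 1" "s + 1 + q = 1 + \<alpha> - \<delta> + 1" "d' - (A - 1) = 1 - y + \<alpha> + 1" "e' - (A - 1) = 1 - z + \<alpha> + 1"
      by (simp_all add: s_def defs)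
    define H where "H m = pochhammer (1 - y + \<alpha> + 1) m * pochhammer (1 - z + \<alpha> + 1) m / fact m *
        (Gamma (s + 1 + of_nat m) * rGamma (1 + \<alpha> - \<beta> + 1 + of_nat m) * rGamma (1 + \<alpha> - \<delta> + 1 + of_nat m))" for m
    have "rGamma d' * rGamma e' * hypergeo_3F2_at_1 (A - 1) p q d' e' = rGamma (A - 1) * suminf H"
    proof -
      have "Re (A - 1) > 0" using psi5 by (simp add: A_def)
      moreover have "Re (s + 1) > 0" using s by simp
      moreover have "Re (x + 1 + \<alpha> - \<beta> - \<delta> + 1) + \<bar>1 - Re (x + 1 + \<alpha> - \<beta> - \<delta> + 1)\<bar> - Re (A - 1) < 1"
        using abs_bound(2)[OF big] by (simp add: A_def)
      ultimately show ?thesis unfolding H_def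
        using rGamma_mult_hypergeo[OF d' e', of "A - 1" p q] thomae_transformation[of "A - 1" d' e' p q]
        unfolding eqs(1) unfolding eqs(2-) by simp
    qed
    \<comment> \<open>The parameters of \<open>H\<close> are those of \<open>G\<close> raised by 1,
      so the two linear factors and \<open>Suc m\<close> turn \<open>H m\<close> into the next term
      of \<open>G\<close>.\<close>
    moreover have H_eq: "(1 - y + \<alpha>) * (1 - z + \<alpha>) * H m = of_nat (Suc m) * G (Suc m)" for m
      unfolding H_def G_def pochhammer_rec fact_Suc using of_nat_neq_0[of m, where 'a = complex]
      by (simp add: add_ac divide_simps del: of_nat_Suc) (simp add: add_ac)
    moreover have nG: "summable (\<lambda>n. of_nat n * G n)"
    proof -
      have "summable (\<lambda>n. \<kappa> * ((\<alpha> + of_nat n) * f n - \<alpha> * f n))"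
        by (intro summable_mult summable_diff summable_f summable_nf)
      then show ?thesis by (simp add: G_eq algebra_simps)
    qed
    moreover have "(1 - y + \<alpha>) * (1 - z + \<alpha>) * suminf H = (\<Sum>n. of_nat n * G n)"
    \<comment> \<open>Summability of \<open>H\<close> is obtained from that of n G n by cancelling
      this product. If the product is 0, then G vanishes from index 1 on and both sides are
      0.\<close>
    proof (cases "(1 - y + \<alpha>) * (1 - z + \<alpha>) = 0")
      case False
      have "summable (\<lambda>m. (1 - y + \<alpha>) * (1 - z + \<alpha>) * H m)"
        unfolding H_eq using nG by (subst summable_Suc_iff)
      then have "summable H" using False by (simp only: summable_cmult_iff) simp
      then have "(1 - y + \<alpha>) * (1 - z + \<alpha>) * suminf H = (\<Sum>m. of_nat (Suc m) * G (Suc m))"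
        unfolding H_eq[symmetric] by (rule suminf_mult[symmetric])
      also have "\<dots> = (\<Sum>n. of_nat n * G n)"
        using suminf_split_head[OF nG] by simp
      finally show ?thesis .
    next
      case True
      then have "of_nat (Suc m) * G (Suc m) = 0" for m using H_eq[of m] by (simp only: mult_zero_left)
      then have "(\<Sum>m. of_nat (Suc m) * G (Suc m)) = 0" by (simp only: suminf_zero)
      then have "(\<Sum>n. of_nat n * G n) = 0" using suminf_split_head[OF nG] by simp
      with True show ?thesis by (simp only: mult_zero_left)
    qed
    ultimately show ?thesis by (simp add: mult_ac)
  qed
  have refl: "sin (of_real pi * u) = of_real pi * (rGamma u * rGamma (1 - u))" for u :: complex
    using rGamma_reflection_complex[of u] by simp
  \<comment> \<open>Reflection at x - \<alpha> contributes a factor \<pi>, and reflection at \<beta>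
    - \<alpha> and \<delta> - \<alpha> contributes 1/\<pi> each, which leaves 1/\<pi>.\<close>
  have V: "V * \<kappa> = w / of_real pi"
  proof -
    have "sin (of_real pi * (x - \<alpha>)) * Gamma s = of_real pi * rGamma (x - \<alpha>)"
    proof -
      have "1 - (x - \<alpha>) = s" by (simp add: s_def)
      moreover have "rGamma s \<noteq> 0" using s' by (simp add: rGamma_eq_zero_iff)
      ultimately show ?thesis unfolding refl by (simp add: Gamma_def)
    qed
    moreover have "rGamma (1 + \<alpha> - \<gamma>) / sin (of_real pi * (\<gamma> - \<alpha>)) = Gamma (\<gamma> - \<alpha>) / of_real pi" if "\<gamma> - \<alpha> \<notin> \<int>" for \<gamma>
    proof -
      have 1: "1 - (\<gamma> - \<alpha>) = 1 + \<alpha> - \<gamma>" by simp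
      have "rGamma (\<gamma> - \<alpha>) \<noteq> 0" "rGamma (1 + \<alpha> - \<gamma>) \<noteq> 0"
        using that nonint[OF that] by (auto simp: rGamma_eq_zero_iff)
      then show ?thesis unfolding refl 1 by (simp add: Gamma_def divide_simps)
    qed
    note this[OF \<beta>] this[OF \<delta>]
    moreover have "V * \<kappa> = (sin (of_real pi * (x - \<alpha>)) * Gamma s) * (rGamma (1 + \<alpha> - \<beta>) / sin (of_real pi * (\<beta> - \<alpha>)))
       * (rGamma (1 + \<alpha> - \<delta>) / sin (of_real pi * (\<delta> - \<alpha>))) * (rGamma (y - \<alpha>) * rGamma (z - \<alpha>))"
      unfolding V_def \<kappa>_def by simp
    ultimately show ?thesis unfolding w_def by (simp add: mult_ac)
  qed
  have weight: "connection_weight x y z \<alpha> \<beta> \<delta> = V * (rGamma d' * rGamma e')"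
    unfolding connection_weight_def Let_def V_def by (simp add: defs)
  have sumG: "suminf G = \<kappa> * suminf f"
    unfolding G_eq by (rule suminf_mult[OF summable_f])
  have A_simps: "\<psi> - 1 = A" "\<psi> - 2 = A - 1" "2 - \<psi> = - (A - 1)" by (simp_all add: A_def)
  have "connection_term0 x y z \<alpha> \<beta> \<delta> = V * (rGamma d' * rGamma e' * hypergeo_3F2_at_1 A p q d' e')"
    unfolding connection_term0_def Let_def weight \<psi>_def[symmetric] A_simps
    by (simp add: p_def q_def d'_def e'_def)
  also have "\<dots> = rGamma A * (V * \<kappa> * suminf f)" unfolding thomae0 sumG by (simp add: mult_ac)
  finally show "connection_term0 x y z \<alpha> \<beta> \<delta> = rGamma (\<psi> - 1) / of_real pi * (w * (\<Sum>n. f n))"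
    unfolding V by (simp add: A_def)
  have "(\<Sum>n. of_nat n * G n) + \<alpha> * suminf G = \<kappa> * (\<Sum>n. (\<alpha> + of_nat n) * f n)"
  proof -
    have nf: "summable (\<lambda>n. of_nat n * f n)"
      using summable_diff[OF summable_nf summable_mult[OF summable_f, of \<alpha>]] by (simp add: algebra_simps)
    have "(\<lambda>n. of_nat n * G n) = (\<lambda>n. \<kappa> * (of_nat n * f n))" by (simp add: G_eq fun_eq_iff)
    then have "(\<Sum>n. of_nat n * G n) = \<kappa> * (\<Sum>n. of_nat n * f n)" using suminf_mult[OF nf] by simp
    moreover have "(\<Sum>n. (\<alpha> + of_nat n) * f n) = \<alpha> * suminf f + (\<Sum>n. of_nat n * f n)"
      unfolding distrib_right
      by (subst suminf_add[symmetric]) (simp_all add: summable_mult summable_f nf suminf_mult)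
    ultimately show ?thesis unfolding sumG by (simp add: algebra_simps)
  qed
  note sum_nG = this
  have "connection_term1 x y z \<alpha> \<beta> \<delta> =
      V * ((1 - y + \<alpha>) * (1 - z + \<alpha>) * (rGamma d' * rGamma e' * hypergeo_3F2_at_1 (A - 1) p q d' e')
         + \<alpha> * (A - 1) * (rGamma d' * rGamma e' * hypergeo_3F2_at_1 A p q d' e'))"
    unfolding connection_term1_def Let_def weight \<psi>_def[symmetric] A_simps
      p_def[symmetric] q_def[symmetric] d'_def[symmetric] e'_def[symmetric]
    by (simp add: algebra_simps)
  also have "\<dots> = V * (rGamma (A - 1) * (\<Sum>n. of_nat n * G n) + \<alpha> * ((A - 1) * rGamma A) * suminf G)"
    unfolding thomae0 thomae1 by (simp add: mult_ac)
  also have "(A - 1) * rGamma A = rGamma (A - 1)" using rGamma_plus1[of "A - 1"] by simp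
  also have "V * (rGamma (A - 1) * (\<Sum>n. of_nat n * G n) + \<alpha> * rGamma (A - 1) * suminf G)
      = V * rGamma (A - 1) * ((\<Sum>n. of_nat n * G n) + \<alpha> * suminf G)" by (simp add: algebra_simps)
  also have "\<dots> = rGamma (A - 1) * (V * \<kappa> * (\<Sum>n. (\<alpha> + of_nat n) * f n))"
    unfolding sum_nG by (simp add: mult_ac)
  finally show "connection_term1 x y z \<alpha> \<beta> \<delta> = rGamma (\<psi> - 2) / of_real pi * (w * (\<Sum>n. (\<alpha> + of_nat n) * f n))"
    unfolding V A_simps by simp
qed

section \<open>Vanishing of the connection sums\<close>

text \<open>The complement of an index may be listed in either order. Expressions symmetric in the
  three indices are reduced to a fixed order by running through the six cases.\<close>

lemma three_index_cases:
  fixes k p q :: nat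
  assumes "k \<in> {1, 2, 3}" "{1, 2, 3} - {k} = {p, q}"
  obtains "k = 1" "p = 2" "q = 3" | "k = 1" "p = 3" "q = 2" | "k = 2" "p = 1" "q = 3"
    | "k = 2" "p = 3" "q = 1" | "k = 3" "p = 1" "q = 2" | "k = 3" "p = 2" "q = 1"
proof -
  have "{1, 2, 3} - {1 :: nat} = {2, 3}" "{1, 2, 3} - {2 :: nat} = {1, 3}" "{1, 2, 3} - {3 :: nat} = {1, 2}"
    by auto
  moreover have "k = 1 \<or> k = 2 \<or> k = 3" using assms(1) by simp
  ultimately have "k = 1 \<and> {p, q} = {2, 3} \<or> k = 2 \<and> {p, q} = {1, 3} \<or> k = 3 \<and> {p, q} = {1, 2}"
    using assms(2) by metis
  then show ?thesis unfolding doubleton_eq_iff using that by blast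
qed

lemma three_index_prod:
  fixes k p q :: nat and h :: "nat \<Rightarrow> complex"
  assumes "k \<in> {1, 2, 3}" "{1, 2, 3} - {k} = {p, q}"
  shows "(\<Prod>i\<in>{1, 2, 3}. h i) = h k * h p * h q"
  using assms by (cases rule: three_index_cases) (simp_all add: mult_ac)

lemma three_index_distinct:
  fixes k p q :: nat
  assumes "k \<in> {1, 2, 3}" "{1, 2, 3} - {k} = {p, q}"
  shows "p \<in> {1, 2, 3}" "q \<in> {1, 2, 3}" "p \<noteq> k" "q \<noteq> k" "p \<noteq> q"
  using assms by (cases rule: three_index_cases; simp)+

lemma nonpos_Ints_plus_of_nat: "d \<notin> \<int>\<^sub>\<le>\<^sub>0 \<Longrightarrow> d + of_nat n \<notin> \<int>\<^sub>\<le>\<^sub>0" for d :: complex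
  by (induction n) (auto dest: nonpos_Ints_plus_1 simp: add_ac)

context
  fixes a :: "nat \<Rightarrow> complex" and k1 k2 :: "nat \<Rightarrow> nat" and x y :: complex
  assumes a_diff: "\<And>j k. j \<in> {1, 2, 3} \<Longrightarrow> k \<in> {1, 2, 3} \<Longrightarrow> j \<noteq> k \<Longrightarrow> a j - a k \<notin> \<int>"
    and k1_k2: "\<And>k. k \<in> {1, 2, 3} \<Longrightarrow> {1, 2, 3} - {k} = {k1 k, k2 k}"
    and Re_less: "\<And>k. k \<in> {1, 2, 3} \<Longrightarrow> Re x < Re (a k + 1)"
begin

lemma connection_sums_eq_0_if_large:
  fixes z :: complex
  defines "\<psi> \<equiv> x + y + z - (a 1 + a 2 + a 3)"
  assumes d: "\<And>k. k \<in> {1, 2, 3} \<Longrightarrow> \<psi> - y + a k \<notin> \<int>\<^sub>\<le>\<^sub>0"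
    and e: "\<And>k. k \<in> {1, 2, 3} \<Longrightarrow> \<psi> - z + a k \<notin> \<int>\<^sub>\<le>\<^sub>0"
    and big: "\<And>k. k \<in> {1, 2, 3} \<Longrightarrow> Re \<psi> > 5 + 2 * \<bar>Re (x + 1 + a k - a (k1 k) - a (k2 k))\<bar>"
  shows "(\<Sum>k\<in>{1, 2, 3}. connection_term0 x y z (a k) (a (k1 k)) (a (k2 k))) = 0"
    and "(\<Sum>k\<in>{1, 2, 3}. connection_term1 x y z (a k) (a (k1 k)) (a (k2 k))) = 0"
proof -
  \<comment> \<open>The assignment of x, y, z to the indices is arbitrary: \<open>b\<close> enters
    the residue sums only through symmetric products and a sum.\<close>
  define b where "b i = (if i = 1 then x else if i = 2 then y else z)" for i :: nat
  define I where "I = {1, 2, 3 :: nat}"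
  have finI: "finite I" and cardI: "card I = 3" by (simp_all add: I_def)
  have sum_b: "(\<Sum>i\<in>I. b i - a i) = \<psi>"
    by (simp add: I_def b_def \<psi>_def)
  have Re_psi: "Re \<psi> > 5"
  proof -
    have "5 + 2 * \<bar>Re (x + 1 + a 1 - a (k1 1) - a (k2 1))\<bar> < Re \<psi>" by (rule big) simp
    then show ?thesis using abs_ge_zero[of "Re (x + 1 + a 1 - a (k1 1) - a (k2 1))"] by linarith
  qed
  have terms: "connection_term0 x y z (a k) (a (k1 k)) (a (k2 k)) =
        rGamma (\<psi> - 1) / of_real pi * (residue_weight I a b k * (\<Sum>n. (a k + of_nat n) ^ 0 * residue_coeff I a b k n)) \<and>
      connection_term1 x y z (a k) (a (k1 k)) (a (k2 k)) =
        rGamma (\<psi> - 2) / of_real pi * (residue_weight I a b k * (\<Sum>n. (a k + of_nat n) ^ 1 * residue_coeff I a b k n))"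
    if k: "k \<in> I" for k
  proof -
    have k': "k \<in> {1, 2, 3}" using k by (simp add: I_def)
    note kk = k1_k2[OF k']
    note dist = three_index_distinct[OF k' kk]
    have prod_b: "(\<Prod>i\<in>I. h (b i)) = h x * h y * h z" for h :: "complex \<Rightarrow> complex"
      by (simp add: I_def b_def)
    have psi_k: "x + y + z - a k - a (k1 k) - a (k2 k) = \<psi>"
      using k' kk by (cases rule: three_index_cases) (simp_all add: \<psi>_def)
    have weight: "residue_weight I a b k =
        rGamma (x - a k) * rGamma (y - a k) * rGamma (z - a k) * Gamma (a (k1 k) - a k) * Gamma (a (k2 k) - a k)"
      unfolding residue_weight_def prod.distrib prod_b[of "\<lambda>u. rGamma (u - a k)"]
      unfolding I_def three_index_prod[OF k' kk, of "\<lambda>i. if i = k then 1 else Gamma (a i - a k)"]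
      using dist by simp
    have coeff: "residue_coeff I a b k n = pochhammer (1 - x + a k) n * pochhammer (1 - y + a k) n * pochhammer (1 - z + a k) n /
             (fact n * pochhammer (1 - a (k1 k) + a k) n * pochhammer (1 - a (k2 k) + a k) n)" for n
      unfolding residue_coeff_def prod_dividef prod_b[of "\<lambda>u. pochhammer (1 - u + a k) n"]
      unfolding I_def three_index_prod[OF k' kk, of "\<lambda>i. pochhammer (1 - a i + a k) n"]
      by (simp add: pochhammer_fact)
    have summ: "summable (\<lambda>n. (a k + of_nat n) ^ m * residue_coeff I a b k n)" if "m \<le> 1" for m
    proof (rule summable_norm_cancel, rule summable_norm_residue_coeff[OF finI k])
      show "a j - a k \<notin> \<int>" if "j \<in> I" "j \<noteq> k" for j using a_diff that k by (auto simp: I_def)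
      show "Re (\<Sum>i\<in>I. b i - a i) > real m + 1" unfolding sum_b using Re_psi that by simp
    qed
    have \<beta>: "a (k1 k) - a k \<notin> \<int>" and \<delta>: "a (k2 k) - a k \<notin> \<int>"
      using a_diff dist k' by auto
    have s0: "summable (residue_coeff I a b k)" using summ[of 0] by simp
    have s1: "summable (\<lambda>n. (a k + of_nat n) * residue_coeff I a b k n)" using summ[of 1] by simp
    note eq = connection_term_eq_residue_sum[of x y z "a k" "a (k1 k)" "a (k2 k)", unfolded psi_k,
        OF d[OF k'] e[OF k'] Re_less[OF k'] \<beta> \<delta> big[OF k'], folded coeff weight, OF s0 s1]
    show ?thesis using eq by simp
  qed
  have a_diff': "a j - a k \<notin> \<int>" if "j \<in> I" "k \<in> I" "j \<noteq> k" for j k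
    using a_diff that by (simp only: I_def)
  have zero: "(\<Sum>k\<in>I. residue_weight I a b k * (\<Sum>n. (a k + of_nat n) ^ m * residue_coeff I a b k n)) = 0" if "m \<le> 1" for m
    using that Re_psi by (intro residue_sum_eq_0 finI a_diff') (simp_all add: cardI sum_b)
  have "(\<Sum>k\<in>I. connection_term0 x y z (a k) (a (k1 k)) (a (k2 k))) =
      rGamma (\<psi> - 1) / of_real pi * (\<Sum>k\<in>I. residue_weight I a b k * (\<Sum>n. (a k + of_nat n) ^ 0 * residue_coeff I a b k n))"
    unfolding sum_distrib_left using terms by (intro sum.cong) auto
  then show "(\<Sum>k\<in>{1, 2, 3}. connection_term0 x y z (a k) (a (k1 k)) (a (k2 k))) = 0"
    unfolding I_def[symmetric] using zero[of 0] by simp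
  have "(\<Sum>k\<in>I. connection_term1 x y z (a k) (a (k1 k)) (a (k2 k))) =
      rGamma (\<psi> - 2) / of_real pi * (\<Sum>k\<in>I. residue_weight I a b k * (\<Sum>n. (a k + of_nat n) ^ 1 * residue_coeff I a b k n))"
    unfolding sum_distrib_left using terms by (intro sum.cong) auto
  then show "(\<Sum>k\<in>{1, 2, 3}. connection_term1 x y z (a k) (a (k1 k)) (a (k2 k))) = 0"
    unfolding I_def[symmetric] using zero[of 1] by simp
qed

text \<open>The coefficients in \<open>connection_term_shift\<close> are symmetric in \<open>(\<alpha>, \<beta>, \<delta>)\<close>, hence the same for all three terms.\<close>

lemma connection_sums_shift:
  fixes z :: complex
  defines "\<psi> \<equiv> x + y + z - (a 1 + a 2 + a 3)"
  assumes d: "\<And>k. k \<in> {1, 2, 3} \<Longrightarrow> \<psi> - y + a k \<notin> \<int>\<^sub>\<le>\<^sub>0"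
    and e: "\<And>k. k \<in> {1, 2, 3} \<Longrightarrow> \<psi> - z + a k \<notin> \<int>\<^sub>\<le>\<^sub>0"
    and zero0: "(\<Sum>k\<in>{1, 2, 3}. connection_term0 x y (z + 1) (a k) (a (k1 k)) (a (k2 k))) = 0"
    and zero1: "(\<Sum>k\<in>{1, 2, 3}. connection_term1 x y (z + 1) (a k) (a (k1 k)) (a (k2 k))) = 0"
  shows "(\<Sum>k\<in>{1, 2, 3}. connection_term0 x y z (a k) (a (k1 k)) (a (k2 k))) = 0"
    and "(\<Sum>k\<in>{1, 2, 3}. connection_term1 x y z (a k) (a (k1 k)) (a (k2 k))) = 0"
proof -
  define c0 where "c0 = (\<psi> - 1) * (z * (1 - x) * (1 - y) - a 1 * a 2 * a 3)"
  define c1 where "c1 = z * (\<psi> - 2) - (1 - x) * (1 - y) + z * (1 - x) + z * (1 - y) + (a 1 * a 2 + a 1 * a 3 + a 2 * a 3)"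
  have shift: "connection_term0 x y z (a k) (a (k1 k)) (a (k2 k)) =
      z * (\<psi> - 1) * connection_term0 x y (z + 1) (a k) (a (k1 k)) (a (k2 k)) - connection_term1 x y (z + 1) (a k) (a (k1 k)) (a (k2 k))"
    "connection_term1 x y z (a k) (a (k1 k)) (a (k2 k)) =
      c0 * connection_term0 x y (z + 1) (a k) (a (k1 k)) (a (k2 k)) + c1 * connection_term1 x y (z + 1) (a k) (a (k1 k)) (a (k2 k))"
    if k: "k \<in> {1, 2, 3}" for k
  proof -
    have psi: "x + y + z - a k - a (k1 k) - a (k2 k) = \<psi>"
      using k k1_k2[OF k] by (cases rule: three_index_cases) (simp_all add: \<psi>_def)
    have e3: "a k * a (k1 k) * a (k2 k) = a 1 * a 2 * a 3"
      using k k1_k2[OF k] by (cases rule: three_index_cases) simp_all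
    have e2: "a k * a (k1 k) + a k * a (k2 k) + a (k1 k) * a (k2 k) = a 1 * a 2 + a 1 * a 3 + a 2 * a 3"
      using k k1_k2[OF k] by (cases rule: three_index_cases) (simp_all add: add_ac mult_ac)
    note eqs = connection_term_shift[of x y z "a k" "a (k1 k)" "a (k2 k)", unfolded psi e2 e3, OF d[OF k] e[OF k] Re_less[OF k],
        folded c0_def c1_def]
    show "connection_term0 x y z (a k) (a (k1 k)) (a (k2 k)) =
      z * (\<psi> - 1) * connection_term0 x y (z + 1) (a k) (a (k1 k)) (a (k2 k)) - connection_term1 x y (z + 1) (a k) (a (k1 k)) (a (k2 k))"
      by (rule eqs(1))
    show "connection_term1 x y z (a k) (a (k1 k)) (a (k2 k)) =
      c0 * connection_term0 x y (z + 1) (a k) (a (k1 k)) (a (k2 k)) + c1 * connection_term1 x y (z + 1) (a k) (a (k1 k)) (a (k2 k))"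
      by (rule eqs(2))
  qed
  have "(\<Sum>k\<in>{1, 2, 3}. connection_term0 x y z (a k) (a (k1 k)) (a (k2 k))) =
     z * (\<psi> - 1) * (\<Sum>k\<in>{1, 2, 3}. connection_term0 x y (z + 1) (a k) (a (k1 k)) (a (k2 k)))
     - (\<Sum>k\<in>{1, 2, 3}. connection_term1 x y (z + 1) (a k) (a (k1 k)) (a (k2 k)))"
    unfolding sum_distrib_left sum_subtractf[symmetric] by (intro sum.cong refl shift)
  then show "(\<Sum>k\<in>{1, 2, 3}. connection_term0 x y z (a k) (a (k1 k)) (a (k2 k))) = 0"
    unfolding zero0 zero1 by simp
  have "(\<Sum>k\<in>{1, 2, 3}. connection_term1 x y z (a k) (a (k1 k)) (a (k2 k))) =
     c0 * (\<Sum>k\<in>{1, 2, 3}. connection_term0 x y (z + 1) (a k) (a (k1 k)) (a (k2 k)))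
     + c1 * (\<Sum>k\<in>{1, 2, 3}. connection_term1 x y (z + 1) (a k) (a (k1 k)) (a (k2 k)))"
    unfolding sum_distrib_left sum.distrib[symmetric] by (intro sum.cong refl shift)
  then show "(\<Sum>k\<in>{1, 2, 3}. connection_term1 x y z (a k) (a (k1 k)) (a (k2 k))) = 0"
    unfolding zero0 zero1 by simp
qed

theorem connection_sums_eq_0:
  fixes z :: complex
  defines "\<psi> \<equiv> x + y + z - (a 1 + a 2 + a 3)"
  assumes d: "\<And>k. k \<in> {1, 2, 3} \<Longrightarrow> \<psi> - y + a k \<notin> \<int>\<^sub>\<le>\<^sub>0"
    and e: "\<And>k. k \<in> {1, 2, 3} \<Longrightarrow> \<psi> - z + a k \<notin> \<int>\<^sub>\<le>\<^sub>0"
  shows "(\<Sum>k\<in>{1, 2, 3}. connection_term0 x y z (a k) (a (k1 k)) (a (k2 k))) = 0"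
    and "(\<Sum>k\<in>{1, 2, 3}. connection_term1 x y z (a k) (a (k1 k)) (a (k2 k))) = 0"
proof -
  define P where "P z \<longleftrightarrow>
      (\<Sum>k\<in>{1, 2, 3}. connection_term0 x y z (a k) (a (k1 k)) (a (k2 k))) = 0 \<and>
      (\<Sum>k\<in>{1, 2, 3}. connection_term1 x y z (a k) (a (k1 k)) (a (k2 k))) = 0" for z
  \<comment> \<open>Raising \<open>z\<close> by \<open>n\<close> moves the first parameter up by
    \<open>n\<close>, where it cannot become a nonpositive integer; the second one is unchanged
    because \<psi> - z is free of \<open>z\<close>.\<close>
  have d_shift: "x + y + (z + of_nat n) - (a 1 + a 2 + a 3) - y + a k \<notin> \<int>\<^sub>\<le>\<^sub>0"
    and e_shift: "x + y + (z + of_nat n) - (a 1 + a 2 + a 3) - (z + of_nat n) + a k \<notin> \<int>\<^sub>\<le>\<^sub>0"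
    if "k \<in> {1, 2, 3}" for k n
    using nonpos_Ints_plus_of_nat[OF d[OF that], of n] e[OF that] by (simp_all add: \<psi>_def algebra_simps)
  \<comment> \<open>\<open>B\<close> dominates the three bounds needed for the individual
    \<open>k\<close> and does not depend on \<open>z\<close>, so one shift \<open>N\<close> serves
    all of them.\<close>
  define B where "B = (\<Sum>k\<in>{1, 2, 3}. \<bar>Re (x + 1 + a k - a (k1 k) - a (k2 k))\<bar>)"
  obtain N :: nat where N: "real N > 5 + 2 * B - Re \<psi>" using reals_Archimedean2 by blast
  have big: "5 + 2 * \<bar>Re (x + 1 + a k - a (k1 k) - a (k2 k))\<bar> < Re (x + y + (z + of_nat N) - (a 1 + a 2 + a 3))"
    if k: "k \<in> {1, 2, 3}" for k
  proof -
    have "\<bar>Re (x + 1 + a k - a (k1 k) - a (k2 k))\<bar> \<le> B"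
      unfolding B_def by (rule member_le_sum[OF k]) auto
    moreover have "Re (x + y + (z + of_nat N) - (a 1 + a 2 + a 3)) = Re \<psi> + real N" by (simp add: \<psi>_def)
    ultimately show ?thesis using N by linarith
  qed
  have "P (z + of_nat N)"
    unfolding P_def by (intro conjI connection_sums_eq_0_if_large d_shift e_shift big)
  moreover have "P (z + of_nat n) \<Longrightarrow> P z" for n
  proof (induction n)
    case (Suc n)
    have "z + of_nat (Suc n) = z + of_nat n + 1" by simp
    with Suc.prems have "P (z + of_nat n + 1)" by (simp only:)
    then have "P (z + of_nat n)" unfolding P_def
      using connection_sums_shift[OF d_shift e_shift, of n] by blast
    then show ?case by (rule Suc.IH)
  qed simp
  ultimately have "P z" by blast
  then show "(\<Sum>k\<in>{1, 2, 3}. connection_term0 x y z (a k) (a (k1 k)) (a (k2 k))) = 0"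
    and "(\<Sum>k\<in>{1, 2, 3}. connection_term1 x y z (a k) (a (k1 k)) (a (k2 k))) = 0"
    by (simp_all add: P_def)
qed

end

theorem corollary3p6:
  fixes a b :: "nat \<Rightarrow> complex" and \<psi> :: complex and T :: "nat \<Rightarrow> complex"
    and i j1 j2 :: nat and k1 k2 :: "nat \<Rightarrow> nat"
  assumes a_diff: "\<And>j k. j \<in> {1, 2, 3} \<Longrightarrow> k \<in> {1, 2, 3} \<Longrightarrow> j \<noteq> k \<Longrightarrow> a j - a k \<notin> \<int>"
    and psi: "\<psi> = (\<Sum>k\<in>{1, 2, 3}. b k - a k)"
    and i: "i \<in> {1, 2, 3}"
    and Re_less: "\<And>k. k \<in> {1, 2, 3} \<Longrightarrow> Re (b i) < Re (a k + 1)"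
    and j1_j2: "{1, 2, 3} - {i} = {j1, j2}"
    and k1_k2: "\<And>k. k \<in> {1, 2, 3} \<Longrightarrow> {1, 2, 3} - {k} = {k1 k, k2 k}"
    and nonpole1: "\<And>k. k \<in> {1, 2, 3} \<Longrightarrow> 1 - b j1 + a k \<notin> \<int>\<^sub>\<le>\<^sub>0"
    and nonpole2: "\<And>k. k \<in> {1, 2, 3} \<Longrightarrow> 1 - b j2 + a k \<notin> \<int>\<^sub>\<le>\<^sub>0"
    and nonpole3: "\<And>k. k \<in> {1, 2, 3} \<Longrightarrow> \<psi> - b j1 + a k \<notin> \<int>\<^sub>\<le>\<^sub>0"
    and nonpole4: "\<And>k. k \<in> {1, 2, 3} \<Longrightarrow> \<psi> - b j2 + a k \<notin> \<int>\<^sub>\<le>\<^sub>0"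
    and T: "\<And>k. k \<in> {1, 2, 3} \<Longrightarrow>
      T k = (\<Prod>j\<in>{1, 2, 3}. sin (of_real pi * (b j - a k))) /
              (sin (of_real pi * (a (k1 k) - a k)) * sin (of_real pi * (a (k2 k) - a k))) *
            (Gamma (1 - b j1 + a k) * Gamma (1 - b j2 + a k) /
              (Gamma (\<psi> - b j1 + a k) * Gamma (\<psi> - b j2 + a k)))"
  shows "(\<Sum>k\<in>{1, 2, 3}. T k *
            hypergeo_3F2_at_1 (\<psi> - 1) (b i - a (k1 k)) (b i - a (k2 k))
              (\<psi> - b j1 + a k) (\<psi> - b j2 + a k)) = 0
    \<and> (\<Sum>k\<in>{1, 2, 3}. T k *
            ((1 - b j1 + a k) * (1 - b j2 + a k) *
               hypergeo_3F2_at_1 (\<psi> - 2) (b i - a (k1 k)) (b i - a (k2 k))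
                 (\<psi> - b j1 + a k) (\<psi> - b j2 + a k)
             - a k * (2 - \<psi>) *
               hypergeo_3F2_at_1 (\<psi> - 1) (b i - a (k1 k)) (b i - a (k2 k))
                 (\<psi> - b j1 + a k) (\<psi> - b j2 + a k))) = 0"
proof -
  define x y z where "x = b i" and "y = b j1" and "z = b j2"
  have psi_eq: "\<psi> = x + y + z - (a 1 + a 2 + a 3)"
    unfolding psi x_def y_def z_def using i j1_j2 by (cases rule: three_index_cases) simp_all
  have T_eq: "T k = of_real (pi ^ 2) * connection_weight x y z (a k) (a (k1 k)) (a (k2 k))"
    and psi_k: "x + y + z - a k - a (k1 k) - a (k2 k) = \<psi>" if k: "k \<in> {1, 2, 3}" for k
  proof -
    show psi_k: "x + y + z - a k - a (k1 k) - a (k2 k) = \<psi>"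
      unfolding psi_eq using k k1_k2[OF k] by (cases rule: three_index_cases) simp_all
    \<comment> \<open>Reflection absorbs the sines belonging to j1 and j2 into the Gamma factors of
      the numerator, each leaving a factor \<pi>; the sine belonging to \<open>i\<close> stays in
      the weight. The first two nonpole conditions permit the cancellation.\<close>
    have sin_Gamma: "sin (of_real pi * (u - a k)) * Gamma (1 - u + a k) = of_real pi * rGamma (u - a k)"
      if "1 - u + a k \<notin> \<int>\<^sub>\<le>\<^sub>0" for u
    proof -
      have "sin (of_real pi * (u - a k)) = of_real pi * (rGamma (u - a k) * rGamma (1 - u + a k))"
        using rGamma_reflection_complex[of "u - a k"] by (simp add: algebra_simps)
      moreover have "rGamma (1 - u + a k) \<noteq> 0" using that by (simp add: rGamma_eq_zero_iff)
      ultimately show ?thesis by (simp add: Gamma_def)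
    qed
    have "T k = sin (of_real pi * (x - a k)) / (sin (of_real pi * (a (k1 k) - a k)) * sin (of_real pi * (a (k2 k) - a k))) *
        ((sin (of_real pi * (y - a k)) * Gamma (1 - y + a k)) * (sin (of_real pi * (z - a k)) * Gamma (1 - z + a k))) *
        (rGamma (\<psi> - y + a k) * rGamma (\<psi> - z + a k))"
      unfolding T[OF k] three_index_prod[OF i j1_j2] x_def y_def z_def
      by (simp add: rGamma_inverse_Gamma field_simps)
    also have "\<dots> = of_real (pi ^ 2) * connection_weight x y z (a k) (a (k1 k)) (a (k2 k))"
      unfolding connection_weight_def Let_def psi_k
      using sin_Gamma[of y] sin_Gamma[of z] nonpole1[OF k] nonpole2[OF k]
      by (simp add: y_def z_def power2_eq_square)
    finally show "T k = of_real (pi ^ 2) * connection_weight x y z (a k) (a (k1 k)) (a (k2 k))" .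
  qed
  have d: "x + y + z - (a 1 + a 2 + a 3) - y + a k \<notin> \<int>\<^sub>\<le>\<^sub>0"
    and e: "x + y + z - (a 1 + a 2 + a 3) - z + a k \<notin> \<int>\<^sub>\<le>\<^sub>0" if "k \<in> {1, 2, 3}" for k
    using nonpole3[OF that] nonpole4[OF that] unfolding psi_eq[symmetric] by (simp_all add: y_def z_def)
  have x: "Re x < Re (a k + 1)" if "k \<in> {1, 2, 3}" for k using Re_less[OF that] by (simp add: x_def)
  note zero = connection_sums_eq_0[of a k1 k2 x y z, OF a_diff k1_k2 x d e]
  have sum0: "(\<Sum>k\<in>{1, 2, 3}. T k *
            hypergeo_3F2_at_1 (\<psi> - 1) (b i - a (k1 k)) (b i - a (k2 k))
              (\<psi> - b j1 + a k) (\<psi> - b j2 + a k))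
     = of_real (pi ^ 2) * (\<Sum>k\<in>{1, 2, 3}. connection_term0 x y z (a k) (a (k1 k)) (a (k2 k)))"
    unfolding sum_distrib_left
    by (intro sum.cong refl) (simp only: T_eq psi_k connection_term0_def Let_def mult.assoc, simp only: x_def y_def z_def)
  have sum1: "(\<Sum>k\<in>{1, 2, 3}. T k *
            ((1 - b j1 + a k) * (1 - b j2 + a k) *
               hypergeo_3F2_at_1 (\<psi> - 2) (b i - a (k1 k)) (b i - a (k2 k))
                 (\<psi> - b j1 + a k) (\<psi> - b j2 + a k)
             - a k * (2 - \<psi>) *
               hypergeo_3F2_at_1 (\<psi> - 1) (b i - a (k1 k)) (b i - a (k2 k))
                 (\<psi> - b j1 + a k) (\<psi> - b j2 + a k)))
     = of_real (pi ^ 2) * (\<Sum>k\<in>{1, 2, 3}. connection_term1 x y z (a k) (a (k1 k)) (a (k2 k)))"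
    unfolding sum_distrib_left
    by (intro sum.cong refl) (simp only: T_eq psi_k connection_term1_def Let_def mult.assoc, simp only: x_def y_def z_def)
  show ?thesis unfolding sum0 sum1 by (simp only: zero mult_zero_right simp_thms)
qed

end
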